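(* There exists a string of resonances corresponding to every $\gamma\in\Gamma$. More precisely, for any $M$ large there exists $h_0>0$ small such that for all $h\in(0,h_0)$, any integer $m$ satisfying $\dfrac{\pi hm}{x_k-x_j}\in\left[\frac2M,\frac M2\right]$ gives a resonance in one of the following forms, where $j<k$ is the pair of indices associated with $\gamma$: $$z_m=\frac{\pi h m}{x_k-x_j}-i\gamma_{jk}\,h\log(1/h)+\frac{ih}{2(x_k-x_j)}\log\!\left(\frac{-C_jC_k(x_k-x_j)^2}{4\pi^2h^2m^2}\right)+o(h),\qquad(\mathrm{A})$$ $$\tilde z_m=\frac{\pi h m}{x_k-x_j}-i\tilde\gamma_{jk}\,h\log(1/h)+\frac{ih}{2(x_k-x_j)}\log\!\left(\frac{-C_j}{C_k}\right)+o(h).\qquad(\mathrm{B})$$ The dominant string ($\gamma=\gamma_{JK}$, with $(j,k)=(J,K)$) is given by (A), and the remaining strings ($\gamma=\tilde\gamma_{jk}\in\Gamma\setminus\{\gamma_{JK}\}$) are given by (B).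
   Context: Setting. Fix an integer $N\ge 2$ and real parameters $x_1<\dots<x_N$, $C_j\neq 0$, $\beta_j>0$ ($1\le j\le N$). For $h>0$ put $V(x)=\sum_{j=1}^N C_jh^{1+\beta_j}\delta(x-x_j)$ on $\mathbb{R}$. Resonances. A resonance (for a given $h>0$) is a $z\in\mathbb{C}\setminus\{0\}$ for which $(-h^2\partial_x^2+V-z^2)u=0$ has a nonzero outgoing solution. Explicitly (with $x_0=-\infty$, $x_{N+1}=+\infty$): there are coefficients $v_j^\pm$, not all zero, with $v_0^+=v_N^-=0$, such that $u(x)=v_j^+e^{izx/h}+v_j^-e^{-izx/h}$ on $(x_j,x_{j+1})$ for $0\le j\le N$ satisfies $u(x_j^-)=u(x_j^+)$ and $h^2\big(u'(x_j^-)-u'(x_j^+)\big)+C_jh^{1+\beta_j}u(x_j)=0$ for $1\le j\le N$. Strings. A string of resonances corresponding to $\gamma$ is a sequence of resonances $z(h_j)$, $h_j\to0^+$, with $\operatorname{Re} z\in U$ for some $U\Subset(0,\infty)$ and $\operatorname{Im} z=-\gamma h\log(1/h)+O(h)$. Newton polygon. Let $P=\{(2(x_k-x_j),\,\beta_j+\beta_k):1\le j<k\le N\}\cup\{(0,0)\}\subset\mathbb{R}^2$, with points written $(\lambda,\nu)$. The Newton polygon is the convex hull of the epigraph $\{(\lambda,t):(\lambda,\nu)\in P,\ t\ge\nu\}$. $\Gamma$ is the (finite) set of its non-infinite slopes, i.e. the slopes of the non-vertical edges of its boundary. Standing assumption. The non-infinite slopes of the Newton polygon are unique, in the sense that for any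 three collinear points of $P$ at least one lies in the interior of the Newton polygon. Slopes. For $1\le j<k\le N$ put $\gamma_{jk}=\dfrac{\beta_k+\beta_j}{2(x_k-x_j)}$ and $\tilde\gamma_{jk}=\dfrac{|\beta_k-\beta_j|}{2(x_k-x_j)}$. Dominant pair. The dominant pair $(J,K)$, $J<K$, is the pair minimizing $\gamma_{jk}$ among all pairs $j<k$ (unique by the standing assumption). $\gamma_{JK}$ is the slope of the edge starting at the origin and is the smallest element of $\Gamma$; the string corresponding to it is the dominant string. Pair associated with a slope. With $\gamma_{JK}$ is associated the pair $(J,K)$. Under the standing assumption, each vertex of the polygon other than the origin comes from exactly one pair of indices, and the pairs at the two endpoints of a non-vertical edge not starting at the origin share exactly one index. For $\gamma\in\Gamma\setminus\{\gamma_{JK}\}$, the associated pair $j<k$ consists of the two indices not shared by the endpoints of the edge of slope $\gamma$; then $\gamma=\tilde\gamma_{jk}$. Conventions. $\log$ of a complex number denotes a fixed branch of the complex logarithm. The $o(h)$ terms are as $h\to0$ with $M$ fixed.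
   Formalization: In (B) the logarithm is log(-C_j/C_k) only when β_j > β_k; when β_j < β_k it is corrected to log(-C_k/C_j), since the printed formula is off there by a multiple of h whenever |C_j| ≠ |C_k|. *)

theory Defs
  imports "HOL-Analysis.Analysis" "HOL-Library.Landau_Symbols"
begin

text \<open>
  The positions \<open>x\<close>, strengths \<open>C\<close> and exponents \<open>\<beta>\<close> are functions on \<open>nat\<close> of which only the
  values at the indices \<open>1, \<dots>, N\<close> matter.
\<close>

definition plane_wave :: "real \<Rightarrow> complex \<Rightarrow> (nat \<Rightarrow> complex) \<Rightarrow> (nat \<Rightarrow> complex) \<Rightarrow> nat \<Rightarrow> real \<Rightarrow> complex"
  where "plane_wave h z vp vm j y =
    vp j * exp (\<i> * z * of_real y / of_real h) + vm j * exp (- \<i> * z * of_real y / of_real h)"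

text \<open>
  An outgoing solution equals \<open>plane_wave h z vp vm j\<close> on the \<open>j\<close>-th interval, \<open>0 \<le> j \<le> N\<close>. Each
  piece is smooth on the whole line, so the one-sided limits of \<open>u\<close> and \<open>u'\<close> at \<open>x j\<close> are the values
  there of pieces \<open>j - 1\<close> (left) and \<open>j\<close> (right) and of their derivatives.
\<close>
definition is_resonance :: "nat \<Rightarrow> (nat \<Rightarrow> real) \<Rightarrow> (nat \<Rightarrow> real) \<Rightarrow> (nat \<Rightarrow> real) \<Rightarrow> real \<Rightarrow> complex \<Rightarrow> bool"
  where "is_resonance N x C \<beta> h z \<longleftrightarrow> z \<noteq> 0 \<and>
    (\<exists>vp vm. (\<exists>j\<le>N. vp j \<noteq> 0 \<or> vm j \<noteq> 0) \<and> vp 0 = 0 \<and> vm N = 0 \<and>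
      (\<forall>j\<in>{1..N}.
        plane_wave h z vp vm (j - 1) (x j) = plane_wave h z vp vm j (x j) \<and>
        of_real (h\<^sup>2) * (vector_derivative (plane_wave h z vp vm (j - 1)) (at (x j))
                       - vector_derivative (plane_wave h z vp vm j) (at (x j)))
          + of_real (C j * h powr (1 + \<beta> j)) * plane_wave h z vp vm j (x j) = 0))"

definition resonance_string ::
  "nat \<Rightarrow> (nat \<Rightarrow> real) \<Rightarrow> (nat \<Rightarrow> real) \<Rightarrow> (nat \<Rightarrow> real) \<Rightarrow> real \<Rightarrow> (nat \<Rightarrow> real) \<Rightarrow> (nat \<Rightarrow> complex) \<Rightarrow> bool"
  where "resonance_string N x C \<beta> \<gamma> hs zs \<longleftrightarrow>
    (\<forall>n. hs n > 0) \<and> hs \<longlonglongrightarrow> 0 \<and>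
    (\<forall>n. is_resonance N x C \<beta> (hs n) (zs n)) \<and>
    (\<exists>U. compact (closure U) \<and> closure U \<subseteq> {0<..} \<and> (\<forall>n. Re (zs n) \<in> U)) \<and>
    (\<lambda>n. Im (zs n) + \<gamma> * hs n * ln (1 / hs n)) \<in> O(hs)"

definition pair_point :: "(nat \<Rightarrow> real) \<Rightarrow> (nat \<Rightarrow> real) \<Rightarrow> nat \<Rightarrow> nat \<Rightarrow> real \<times> real"
  where "pair_point x \<beta> j k = (2 * (x k - x j), \<beta> j + \<beta> k)"

definition newton_points :: "nat \<Rightarrow> (nat \<Rightarrow> real) \<Rightarrow> (nat \<Rightarrow> real) \<Rightarrow> (real \<times> real) set"
  where "newton_points N x \<beta> = {pair_point x \<beta> j k |j k. 1 \<le> j \<and> j < k \<and> k \<le> N} \<union> {(0, 0)}"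

definition newton_polygon :: "nat \<Rightarrow> (nat \<Rightarrow> real) \<Rightarrow> (nat \<Rightarrow> real) \<Rightarrow> (real \<times> real) set"
  where "newton_polygon N x \<beta> =
    convex hull {(l, t). \<exists>\<nu>. (l, \<nu>) \<in> newton_points N x \<beta> \<and> \<nu> \<le> t}"

text \<open>
  The polygon is unbounded only in the upward direction, so its non-vertical edges are exactly the
  one-dimensional faces that are segments with endpoints of different abscissae.
\<close>
definition newton_edge ::
  "nat \<Rightarrow> (nat \<Rightarrow> real) \<Rightarrow> (nat \<Rightarrow> real) \<Rightarrow> real \<times> real \<Rightarrow> real \<times> real \<Rightarrow> bool"
  where "newton_edge N x \<beta> p q \<longleftrightarrow> fst p < fst q \<and> closed_segment p q edge_of newton_polygon N x \<beta>"

definition slope :: "real \<times> real \<Rightarrow> real \<times> real \<Rightarrow> real"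
  where "slope p q = (snd q - snd p) / (fst q - fst p)"

definition newton_slopes :: "nat \<Rightarrow> (nat \<Rightarrow> real) \<Rightarrow> (nat \<Rightarrow> real) \<Rightarrow> real set"
  where "newton_slopes N x \<beta> = {slope p q |p q. newton_edge N x \<beta> p q}"

definition slopes_unique :: "nat \<Rightarrow> (nat \<Rightarrow> real) \<Rightarrow> (nat \<Rightarrow> real) \<Rightarrow> bool"
  where "slopes_unique N x \<beta> \<longleftrightarrow>
    (\<forall>a\<in>newton_points N x \<beta>. \<forall>b\<in>newton_points N x \<beta>. \<forall>c\<in>newton_points N x \<beta>.
       a \<noteq> b \<and> a \<noteq> c \<and> b \<noteq> c \<and> collinear {a, b, c} \<longrightarrow>
       a \<in> interior (newton_polygon N x \<beta>) \<or> b \<in> interior (newton_polygon N x \<beta>) \<or>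
       c \<in> interior (newton_polygon N x \<beta>))"

definition gamma_sum :: "(nat \<Rightarrow> real) \<Rightarrow> (nat \<Rightarrow> real) \<Rightarrow> nat \<Rightarrow> nat \<Rightarrow> real"
  where "gamma_sum x \<beta> j k = (\<beta> k + \<beta> j) / (2 * (x k - x j))"

definition gamma_diff :: "(nat \<Rightarrow> real) \<Rightarrow> (nat \<Rightarrow> real) \<Rightarrow> nat \<Rightarrow> nat \<Rightarrow> real"
  where "gamma_diff x \<beta> j k = \<bar>\<beta> k - \<beta> j\<bar> / (2 * (x k - x j))"

definition dominant_pair :: "nat \<Rightarrow> (nat \<Rightarrow> real) \<Rightarrow> (nat \<Rightarrow> real) \<Rightarrow> nat \<Rightarrow> nat \<Rightarrow> bool"
  where "dominant_pair N x \<beta> J K \<longleftrightarrow> 1 \<le> J \<and> J < K \<and> K \<le> N \<and>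
    (\<forall>j k. 1 \<le> j \<and> j < k \<and> k \<le> N \<longrightarrow> gamma_sum x \<beta> J K \<le> gamma_sum x \<beta> j k)"

text \<open>
  The second alternative concerns edges not starting at the origin, since the first coordinate of
  \<open>pair_point x \<beta> a b\<close> is positive for \<open>a < b\<close>. The symmetric difference of \<open>{a, b}\<close> and \<open>{c, d}\<close>
  has exactly two elements \<open>j\<close>, \<open>k\<close> iff the two pairs share exactly one index.
\<close>
definition associated_pair ::
  "nat \<Rightarrow> (nat \<Rightarrow> real) \<Rightarrow> (nat \<Rightarrow> real) \<Rightarrow> real \<Rightarrow> nat \<Rightarrow> nat \<Rightarrow> bool"
  where "associated_pair N x \<beta> \<gamma> j k \<longleftrightarrow> j < k \<and>
    (dominant_pair N x \<beta> j k \<and> \<gamma> = gamma_sum x \<beta> j k \<or>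
     (\<exists>a b c d. 1 \<le> a \<and> a < b \<and> b \<le> N \<and> 1 \<le> c \<and> c < d \<and> d \<le> N \<and>
        newton_edge N x \<beta> (pair_point x \<beta> a b) (pair_point x \<beta> c d) \<and>
        \<gamma> = slope (pair_point x \<beta> a b) (pair_point x \<beta> c d) \<and>
        sym_diff {a, b} {c, d} = {j, k}))"

definition z_dominant ::
  "(nat \<Rightarrow> real) \<Rightarrow> (nat \<Rightarrow> real) \<Rightarrow> (nat \<Rightarrow> real) \<Rightarrow> nat \<Rightarrow> nat \<Rightarrow> real \<Rightarrow> int \<Rightarrow> complex"
  where "z_dominant x C \<beta> j k h m =
    of_real (pi * h * of_int m / (x k - x j))
    - \<i> * of_real (gamma_sum x \<beta> j k * h * ln (1 / h))
    + \<i> * of_real (h / (2 * (x k - x j)))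
        * Ln (of_real (- C j * C k * (x k - x j)\<^sup>2 / (4 * pi\<^sup>2 * h\<^sup>2 * (of_int m)\<^sup>2)))"

text \<open>
  In the logarithm the strength with the larger exponent is the numerator: if the edge joins the
  points of \<open>{a, j}\<close> and \<open>{a, k}\<close>, balancing the two terms gives
  \<open>exp (2 i z (x k - x j) / h) = - (C j / C k) h powr (\<beta> j - \<beta> k)\<close> when \<open>a\<close> lies left of \<open>j\<close> and
  \<open>k\<close> (and then \<open>\<beta> j < \<beta> k\<close>), and
  \<open>exp (2 i z (x k - x j) / h) = - (C k / C j) h powr (\<beta> k - \<beta> j)\<close> when \<open>a\<close> lies to their right
  (and then \<open>\<beta> k < \<beta> j\<close>). The formula with \<open>- C j / C k\<close> in both cases is wrong: the reflection
  \<open>x \<mapsto> - x\<close> preserves resonances and interchanges the two cases and the roles of \<open>j\<close> and \<open>k\<close>.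
\<close>
definition z_secondary ::
  "(nat \<Rightarrow> real) \<Rightarrow> (nat \<Rightarrow> real) \<Rightarrow> (nat \<Rightarrow> real) \<Rightarrow> nat \<Rightarrow> nat \<Rightarrow> real \<Rightarrow> int \<Rightarrow> complex"
  where "z_secondary x C \<beta> j k h m =
    of_real (pi * h * of_int m / (x k - x j))
    - \<i> * of_real (gamma_diff x \<beta> j k * h * ln (1 / h))
    + \<i> * of_real (h / (2 * (x k - x j)))
        * Ln (of_real (if \<beta> k < \<beta> j then - C j / C k else - C k / C j))"

end

theory Submission
  imports Defs "HOL-Real_Asymp.Real_Asymp"
begin

text \<open>
  To the left of all interactions take the outgoing solution \<open>exp (- \<i> z y / h)\<close> and continue it
  to the right, one interaction after the other. It is outgoing on the right iff its left-moving
  coefficient there, the secular function, is zero; so every zero is a resonance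
  (\<open>secular_zero_imp_resonance\<close>). The coefficient is a polynomial in the couplings
  \<open>a j = C j h\<^bsup>\<beta> j\<^esup> / (2 \<i> z)\<close> and the phases \<open>exp (2 \<i> z (x k - x j) / h)\<close>. When
  \<open>Im z = - \<gamma> h log (1/h) + O(h)\<close>, a phase has the size \<open>h\<close> to the power \<open>- 2 \<gamma> (x k - x j)\<close>, and the
  secular function is

    \<open>1 - (sum of a j * a k * exp (2 \<i> z (x k - x j) / h) over pairs j < k)\<close>

  up to terms that are smaller than the largest one by a power of \<open>h\<close>
  (\<open>secular_pair_expansion\<close>). The term of a pair has the size \<open>h\<close> to the power \<open>\<nu> - \<gamma> l\<close>, where
  \<open>(l, \<nu>)\<close> is its point in the Newton polygon, and the constant 1 corresponds to the origin. So the
  largest terms are those whose points minimize \<open>\<nu> - \<gamma> l\<close>, and there are at least two of them iff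
  \<open>\<gamma>\<close> is a slope of the polygon. The uniqueness of the slopes makes them exactly two
  (\<open>no_three_minimizers\<close>, \<open>at_most_two_minimizing_pairs\<close>); two minimizing pairs have an index in
  common, because exchanging the right ends of two pairs does not change the sum of their exponents,
  so that otherwise there would be more than two minimizers
  (\<open>minimizing_pairs_share_index\<close>).

  Balancing the two largest terms gives an equation \<open>exp (2 \<i> z \<Delta> / h) = const\<close>, where \<open>\<Delta>\<close> is the
  distance of the associated pair; its solutions are the predicted positions. With \<open>z = z0 + h \<zeta>\<close>
  the full equation becomes \<open>exp (2 \<i> \<Delta> \<zeta>) = 1 + R \<zeta>\<close> with \<open>R\<close> uniformly small, which has a
  solution \<open>\<zeta> = O(R)\<close> by Brouwer's fixed point theorem (\<open>exp_equation_perturbed\<close>). This puts a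
  resonance at distance \<open>o(h)\<close> from \<open>z0\<close> (\<open>dominant_resonances\<close>, \<open>secondary_resonances\<close>).
\<close>

section \<open>Supporting lines of the Newton polygon\<close>

text \<open>
  Among lines of slope \<open>\<gamma>\<close>, the one through \<open>p\<close> meets the vertical axis at height \<open>tilt \<gamma> p\<close>;
  a term of size \<open>h powr \<nu>\<close> times \<open>h powr (- \<gamma> * l)\<close> has the exponent \<open>tilt \<gamma> (l, \<nu>)\<close>.
\<close>
definition tilt :: "real \<Rightarrow> real \<times> real \<Rightarrow> real"
  where "tilt \<gamma> p = snd p - \<gamma> * fst p"

lemma tilt_add: "tilt \<gamma> (p + q) = tilt \<gamma> p + tilt \<gamma> q"
  by (simp add: tilt_def algebra_simps)

lemma tilt_scaleR: "tilt \<gamma> (c *\<^sub>R p) = c * tilt \<gamma> p"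
  by (simp add: tilt_def algebra_simps)

lemma tilt_slope:
  assumes "fst p < fst q"
  shows "tilt (slope p q) p = tilt (slope p q) q"
proof -
  have "slope p q * (fst q - fst p) = snd q - snd p"
    using assms by (simp add: slope_def)
  thus ?thesis by (simp add: tilt_def algebra_simps)
qed

lemma eq_if_fst_tilt_eq: "fst p = fst q \<Longrightarrow> tilt \<gamma> p = tilt \<gamma> q \<Longrightarrow> p = q"
  by (simp add: tilt_def prod_eq_iff)

lemma newton_points_subset_polygon: "newton_points N x \<beta> \<subseteq> newton_polygon N x \<beta>"
  unfolding newton_polygon_def by (rule order_trans[OF _ hull_subset]) auto

lemma newton_polygon_upward:
  assumes "p \<in> newton_polygon N x \<beta>" and "0 \<le> s"
  shows "p + (0, s) \<in> newton_polygon N x \<beta>"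
proof -
  define S where "S = {(l, t). \<exists>\<nu>. (l, \<nu>) \<in> newton_points N x \<beta> \<and> \<nu> \<le> t}"
  have "convex hull S \<subseteq> {p. p + (0, s) \<in> convex hull S}"
  proof (rule hull_minimal)
    show "S \<subseteq> {p. p + (0, s) \<in> convex hull S}"
      using \<open>0 \<le> s\<close> by (auto simp: S_def intro!: hull_inc; meson add_increasing2)
    show "convex {p. p + (0, s) \<in> convex hull S}"
    proof (rule convexI)
      fix p q and u v :: real
      assume pq: "p \<in> {p. p + (0, s) \<in> convex hull S}" "q \<in> {p. p + (0, s) \<in> convex hull S}"
        and uv: "0 \<le> u" "0 \<le> v" "u + v = 1"
      have "u *\<^sub>R (p + (0, s)) + v *\<^sub>R (q + (0, s)) \<in> convex hull S"
        using pq uv by (intro convexD[OF convex_convex_hull]) auto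
      moreover have "u *\<^sub>R (p + (0, s)) + v *\<^sub>R (q + (0, s)) = u *\<^sub>R p + v *\<^sub>R q + (0, s)"
      proof -
        have "u *\<^sub>R (p + (0, s)) + v *\<^sub>R (q + (0, s)) = u *\<^sub>R p + v *\<^sub>R q + (u + v) *\<^sub>R (0, s)"
          by (simp add: algebra_simps del: scaleR_Pair)
        thus ?thesis using uv by simp
      qed
      ultimately show "u *\<^sub>R p + v *\<^sub>R q \<in> {p. p + (0, s) \<in> convex hull S}" by simp
    qed
  qed
  with assms show ?thesis by (auto simp: newton_polygon_def S_def)
qed

text \<open>
  The polygon is generated by vertical rays starting at the points, and \<open>tilt \<gamma>\<close> increases along
  each of them. It is therefore minimal on a generator only at the foot of its ray, and minimal at
  a convex combination only if it is minimal at every generator of positive weight.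
\<close>
lemma tilt_minimum_on_polygon:
  assumes min: "\<And>p. p \<in> newton_points N x \<beta> \<Longrightarrow> \<mu> \<le> tilt \<gamma> p"
    and s: "s \<in> newton_polygon N x \<beta>"
  shows "\<mu> \<le> tilt \<gamma> s"
    and "tilt \<gamma> s = \<mu> \<Longrightarrow> s \<in> convex hull {p \<in> newton_points N x \<beta>. tilt \<gamma> p = \<mu>}"
proof -
  define S where "S = {(l, t). \<exists>\<nu>. (l, \<nu>) \<in> newton_points N x \<beta> \<and> \<nu> \<le> t}"
  define H where "H = convex hull {p \<in> newton_points N x \<beta>. tilt \<gamma> p = \<mu>}"
  have "convex hull S \<subseteq> {s. \<mu> \<le> tilt \<gamma> s \<and> (tilt \<gamma> s = \<mu> \<longrightarrow> s \<in> H)}"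
  proof (rule hull_minimal)
    show "S \<subseteq> {s. \<mu> \<le> tilt \<gamma> s \<and> (tilt \<gamma> s = \<mu> \<longrightarrow> s \<in> H)}"
    proof
      fix s assume "s \<in> S"
      then obtain l t \<nu> where s: "s = (l, t)" "(l, \<nu>) \<in> newton_points N x \<beta>" "\<nu> \<le> t"
        by (auto simp: S_def)
      have 1: "\<mu> \<le> \<nu> - \<gamma> * l" using min[OF s(2)] by (simp add: tilt_def)
      have "s \<in> H" if "t - \<gamma> * l = \<mu>"
      proof -
        have "t = \<nu>" using 1 s(3) that by simp
        thus ?thesis using s(1,2) that by (auto simp: H_def tilt_def intro!: hull_inc)
      qed
      thus "s \<in> {s. \<mu> \<le> tilt \<gamma> s \<and> (tilt \<gamma> s = \<mu> \<longrightarrow> s \<in> H)}"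
        using 1 s by (auto simp: tilt_def)
    qed
    show "convex {s. \<mu> \<le> tilt \<gamma> s \<and> (tilt \<gamma> s = \<mu> \<longrightarrow> s \<in> H)}"
    proof (rule convexI)
      fix p q and u v :: real
      assume p: "p \<in> {s. \<mu> \<le> tilt \<gamma> s \<and> (tilt \<gamma> s = \<mu> \<longrightarrow> s \<in> H)}"
        and q: "q \<in> {s. \<mu> \<le> tilt \<gamma> s \<and> (tilt \<gamma> s = \<mu> \<longrightarrow> s \<in> H)}"
        and uv: "0 \<le> u" "0 \<le> v" "u + v = 1"
      have eq: "tilt \<gamma> (u *\<^sub>R p + v *\<^sub>R q) = \<mu> + (u * (tilt \<gamma> p - \<mu>) + v * (tilt \<gamma> q - \<mu>))"
      proof -
        have "v = 1 - u" using uv by simp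
        thus ?thesis by (simp only: tilt_add tilt_scaleR) (simp add: algebra_simps)
      qed
      have nn: "0 \<le> u * (tilt \<gamma> p - \<mu>)" "0 \<le> v * (tilt \<gamma> q - \<mu>)"
        using p q uv by auto
      have "u *\<^sub>R p + v *\<^sub>R q \<in> H" if "tilt \<gamma> (u *\<^sub>R p + v *\<^sub>R q) = \<mu>"
      proof -
        have z: "u * (tilt \<gamma> p - \<mu>) = 0" "v * (tilt \<gamma> q - \<mu>) = 0"
          using nn eq that by linarith+
        consider "u = 0" | "v = 0" | "tilt \<gamma> p = \<mu>" "tilt \<gamma> q = \<mu>" using z by auto
        thus ?thesis
        proof cases
          case 3
          thus ?thesis using p q uv by (auto simp: H_def intro: convexD[OF convex_convex_hull])
        qed (use p q uv z in auto)
      qed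
      thus "u *\<^sub>R p + v *\<^sub>R q \<in> {s. \<mu> \<le> tilt \<gamma> s \<and> (tilt \<gamma> s = \<mu> \<longrightarrow> s \<in> H)}"
        using eq nn by auto
    qed
  qed
  thus "\<mu> \<le> tilt \<gamma> s"
    and "tilt \<gamma> s = \<mu> \<Longrightarrow> s \<in> convex hull {p \<in> newton_points N x \<beta>. tilt \<gamma> p = \<mu>}"
    using s by (auto simp: newton_polygon_def S_def H_def)
qed

text \<open>
  If some point \<open>s\<close> of the polygon were below the line through \<open>p\<close> and \<open>q\<close>, then the midpoint of
  \<open>p\<close> and \<open>q\<close> would lie strictly between \<open>s\<close> and a point slightly above the segment; the latter is
  in the polygon, which is closed upwards, so \<open>s\<close> would belong to the face.
\<close>
lemma newton_edge_supports:
  assumes edge: "newton_edge N x \<beta> p q" and s: "s \<in> newton_polygon N x \<beta>"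
  shows "tilt (slope p q) p \<le> tilt (slope p q) s"
proof (rule ccontr)
  define \<gamma> where "\<gamma> = slope p q"
  assume "\<not> tilt (slope p q) p \<le> tilt (slope p q) s"
  hence below: "tilt \<gamma> s < tilt \<gamma> p" by (simp add: \<gamma>_def)
  have lt: "fst p < fst q" and face: "closed_segment p q face_of newton_polygon N x \<beta>"
    using edge by (auto simp: newton_edge_def edge_of_def)
  have tq: "tilt \<gamma> q = tilt \<gamma> p" using tilt_slope[OF lt] by (simp add: \<gamma>_def)
  define c where "c = (1/2) *\<^sub>R p + (1/2) *\<^sub>R q"
  define d where "d = (fst q - fst p) / 2"
  have d: "d > 0" using lt by (simp add: d_def)
  define \<epsilon> where "\<epsilon> = d / (d + \<bar>fst c - fst s\<bar>)"
  have \<epsilon>: "\<epsilon> > 0" "\<epsilon> * \<bar>fst c - fst s\<bar> \<le> d"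
    using d by (auto simp: \<epsilon>_def field_simps)
  define r where "r = c + \<epsilon> *\<^sub>R (c - s)"
  have tc: "tilt \<gamma> c = tilt \<gamma> p" using tq by (simp add: c_def tilt_add tilt_scaleR)
  have tr: "tilt \<gamma> r = tilt \<gamma> p + \<epsilon> * (tilt \<gamma> p - tilt \<gamma> s)"
  proof -
    have "tilt \<gamma> r = tilt \<gamma> c + \<epsilon> * (tilt \<gamma> c - tilt \<gamma> s)"
      by (simp add: r_def tilt_def algebra_simps)
    thus ?thesis by (simp add: tc)
  qed
  have tr': "tilt \<gamma> p < tilt \<gamma> r" using tr \<epsilon>(1) below by simp
  define t where "t = \<epsilon> * (fst c - fst s)"
  have fr: "fst r = (fst p + fst q) / 2 + t"
    by (simp add: r_def c_def t_def field_simps)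
  have "\<bar>t\<bar> \<le> d" using \<epsilon> by (simp add: t_def abs_mult)
  hence fr': "fst p \<le> fst r" "fst r \<le> fst q" using fr d_def by argo+
  define u where "u = (fst r - fst p) / (fst q - fst p)"
  have u: "0 \<le> u" "u \<le> 1" using fr' lt by (auto simp: u_def)
  define r0 where "r0 = (1 - u) *\<^sub>R p + u *\<^sub>R q"
  have "u * (fst q - fst p) = fst r - fst p" using lt by (simp add: u_def)
  hence f0: "fst r0 = fst r" by (simp add: r0_def algebra_simps)
  have t0: "tilt \<gamma> r0 = tilt \<gamma> p" unfolding r0_def tilt_add tilt_scaleR tq by (simp add: algebra_simps)
  have seg: "r0 \<in> closed_segment p q"
    unfolding in_segment r0_def using u by (intro exI[of _ u]) simp
  have mid: "c \<in> closed_segment p q"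
    unfolding in_segment c_def by (intro exI[of _ "1/2"]) simp
  have sub: "closed_segment p q \<subseteq> newton_polygon N x \<beta>" using face by (rule face_of_imp_subset)
  have "r = r0 + (0, tilt \<gamma> r - tilt \<gamma> p)"
    by (rule eq_if_fst_tilt_eq[of _ _ \<gamma>]) (use f0 t0 in \<open>auto simp: tilt_add\<close>, simp add: tilt_def)
  hence r: "r \<in> newton_polygon N x \<beta>"
    using newton_polygon_upward[of r0 N x \<beta> "tilt \<gamma> r - tilt \<gamma> p"] tr' seg sub by auto
  have "c = (1 - \<epsilon>/(1+\<epsilon>)) *\<^sub>R r + (\<epsilon>/(1+\<epsilon>)) *\<^sub>R s"
  proof -
    have "(1 + \<epsilon>) *\<^sub>R ((1 - \<epsilon>/(1+\<epsilon>)) *\<^sub>R r + (\<epsilon>/(1+\<epsilon>)) *\<^sub>R s) = r + \<epsilon> *\<^sub>R s"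
      using \<epsilon>(1) by (simp add: scaleR_add_right field_simps)
    also have "\<dots> = (1 + \<epsilon>) *\<^sub>R c" by (simp add: r_def algebra_simps)
    finally show ?thesis using \<epsilon>(1) by (metis add_pos_pos less_numeral_extra(1,3) scaleR_cancel_left)
  qed
  moreover have "r \<noteq> s" using tr' below by auto
  moreover have "0 < \<epsilon> / (1 + \<epsilon>)" "\<epsilon> / (1 + \<epsilon>) < 1" using \<epsilon>(1) by simp_all
  ultimately have "c \<in> open_segment r s" unfolding in_segment by blast
  hence "s \<in> closed_segment p q"
    using face r s mid by (auto simp: face_of_def)
  then obtain v where "s = (1 - v) *\<^sub>R p + v *\<^sub>R q" by (auto simp: in_segment)
  hence "tilt \<gamma> s = (1 - v) * tilt \<gamma> p + v * tilt \<gamma> p" using tq by (simp add: tilt_add tilt_scaleR)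
  hence "tilt \<gamma> s = tilt \<gamma> p" by (simp add: algebra_simps)
  thus False using below by simp
qed

text \<open>
  The endpoints are extreme, so they are generators of the hull; they are feet of their rays
  because everything below a foot is below the supporting line.
\<close>
lemma newton_edge_endpoints:
  assumes edge: "newton_edge N x \<beta> p q"
  shows "p \<in> newton_points N x \<beta>" and "q \<in> newton_points N x \<beta>"
proof -
  define \<gamma> where "\<gamma> = slope p q"
  have lt: "fst p < fst q" and face: "closed_segment p q face_of newton_polygon N x \<beta>"
    using edge by (auto simp: newton_edge_def edge_of_def)
  have tq: "tilt \<gamma> q = tilt \<gamma> p" using tilt_slope[OF lt] by (simp add: \<gamma>_def)
  have *: "r \<in> newton_points N x \<beta>" if "r = p \<or> r = q" for r
  proof -
    have "{r} face_of closed_segment p q"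
      using that by (simp add: face_of_singleton extreme_point_of_segment)
    hence "{r} face_of newton_polygon N x \<beta>" using face by (rule face_of_trans)
    hence "r extreme_point_of convex hull {(l, t). \<exists>\<nu>. (l, \<nu>) \<in> newton_points N x \<beta> \<and> \<nu> \<le> t}"
      by (simp add: face_of_singleton newton_polygon_def)
    hence "r \<in> {(l, t). \<exists>\<nu>. (l, \<nu>) \<in> newton_points N x \<beta> \<and> \<nu> \<le> t}"
      by (rule extreme_point_of_convex_hull)
    then obtain \<nu> where \<nu>: "(fst r, \<nu>) \<in> newton_points N x \<beta>" "\<nu> \<le> snd r" by auto
    have "tilt \<gamma> p \<le> tilt \<gamma> (fst r, \<nu>)"
      unfolding \<gamma>_def using newton_points_subset_polygon \<nu>(1)
      by (intro newton_edge_supports[OF edge]) auto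
    moreover have "tilt \<gamma> r = tilt \<gamma> p" using that tq by auto
    ultimately have "snd r = \<nu>" using \<nu>(2) by (simp add: tilt_def)
    thus ?thesis using \<nu>(1) by (metis prod.collapse)
  qed
  show "p \<in> newton_points N x \<beta>" "q \<in> newton_points N x \<beta>" using * by auto
qed

text \<open>
  The part of the polygon on a supporting line is a face, and by
  \<open>tilt_minimum_on_polygon\<close> it is spanned by the minimizing points.
\<close>
lemma newton_edge_if_only_minimizers:
  assumes min: "\<And>r. r \<in> newton_points N x \<beta> \<Longrightarrow> \<mu> \<le> tilt \<gamma> r"
    and only: "{r \<in> newton_points N x \<beta>. tilt \<gamma> r = \<mu>} = {p, q}"
    and lt: "fst p < fst q"
  shows "newton_edge N x \<beta> p q" and "slope p q = \<gamma>"
proof -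
  have pq: "p \<in> newton_points N x \<beta>" "q \<in> newton_points N x \<beta>" "tilt \<gamma> p = \<mu>" "tilt \<gamma> q = \<mu>"
    using only by auto
  show "slope p q = \<gamma>" using pq(3,4) lt by (auto simp: tilt_def slope_def field_simps)
  define n :: "real \<times> real" where "n = (- \<gamma>, 1)"
  have n: "n \<bullet> s = tilt \<gamma> s" for s by (cases s) (simp add: n_def tilt_def)
  have cv: "convex (newton_polygon N x \<beta>)" by (simp add: newton_polygon_def)
  have "newton_polygon N x \<beta> \<inter> {s. n \<bullet> s = \<mu>} = closed_segment p q"
  proof (intro equalityI subsetI)
    fix s assume "s \<in> newton_polygon N x \<beta> \<inter> {s. n \<bullet> s = \<mu>}"
    hence "s \<in> convex hull {r \<in> newton_points N x \<beta>. tilt \<gamma> r = \<mu>}"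
      using tilt_minimum_on_polygon(2)[OF min] by (auto simp: n)
    thus "s \<in> closed_segment p q" unfolding only by (simp add: segment_convex_hull)
  next
    fix s assume s: "s \<in> closed_segment p q"
    have "closed_segment p q \<subseteq> newton_polygon N x \<beta>"
      using pq newton_points_subset_polygon cv by (intro closed_segment_subset) auto
    moreover have "tilt \<gamma> s = \<mu>"
    proof -
      obtain v where "s = (1 - v) *\<^sub>R p + v *\<^sub>R q" using s by (auto simp: in_segment)
      hence "tilt \<gamma> s = (1 - v) * tilt \<gamma> p + v * tilt \<gamma> q" by (simp add: tilt_add tilt_scaleR)
      thus ?thesis using pq by (simp add: algebra_simps)
    qed
    ultimately show "s \<in> newton_polygon N x \<beta> \<inter> {s. n \<bullet> s = \<mu>}" using s by (auto simp: n)
  qed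
  moreover have "newton_polygon N x \<beta> \<inter> {s. n \<bullet> s = \<mu>} face_of newton_polygon N x \<beta>"
    using tilt_minimum_on_polygon(1)[OF min]
    by (intro face_of_Int_supporting_hyperplane_ge[OF cv]) (simp add: n)
  moreover have "aff_dim (closed_segment p q) = 1"
  proof -
    have "p \<noteq> q" using lt by auto
    thus ?thesis by (simp add: segment_convex_hull aff_dim_convex_hull aff_dim_2)
  qed
  ultimately show "newton_edge N x \<beta> p q" using lt by (simp add: newton_edge_def edge_of_def)
qed

text \<open>
  Minimizing points are on one line, and not in the interior because the polygon does not continue
  below them, so the uniqueness of the slopes allows at most two.
\<close>
lemma no_three_minimizers:
  assumes uniq: "slopes_unique N x \<beta>"
    and min: "\<And>p. p \<in> newton_points N x \<beta> \<Longrightarrow> \<mu> \<le> tilt \<gamma> p"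
    and pts: "{p, q, r} \<subseteq> newton_points N x \<beta>"
    and tilts: "tilt \<gamma> p = \<mu>" "tilt \<gamma> q = \<mu>" "tilt \<gamma> r = \<mu>"
    and distinct: "fst p \<noteq> fst q" "fst p \<noteq> fst r" "fst q \<noteq> fst r"
  shows False
proof -
  have not_interior: "s \<notin> interior (newton_polygon N x \<beta>)" if "tilt \<gamma> s = \<mu>" for s
  proof
    assume "s \<in> interior (newton_polygon N x \<beta>)"
    then obtain e where e: "e > 0" "ball s e \<subseteq> newton_polygon N x \<beta>"
      by (auto simp: mem_interior)
    have "s - (0, e/2) \<in> ball s e" using e(1) by (simp add: dist_norm norm_Pair)
    hence "s - (0, e/2) \<in> newton_polygon N x \<beta>" using e(2) by blast
    from tilt_minimum_on_polygon(1)[OF min this] show False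
      using that e(1) by (simp add: tilt_def algebra_simps)
  qed
  have "collinear {p, q, r}"
    unfolding collinear_def
  proof (intro exI ballI)
    fix a b assume "a \<in> {p, q, r}" "b \<in> {p, q, r}"
    hence "tilt \<gamma> a = \<mu>" "tilt \<gamma> b = \<mu>" using tilts by auto
    thus "a - b = (fst a - fst b) *\<^sub>R (1, \<gamma>)"
      by (auto simp: tilt_def prod_eq_iff algebra_simps)
  qed
  moreover have "p \<noteq> q" "p \<noteq> r" "q \<noteq> r" using distinct by auto
  ultimately show False
    using uniq pts not_interior tilts unfolding slopes_unique_def by blast
qed

section \<open>The secular function\<close>

definition coupling :: "(nat \<Rightarrow> real) \<Rightarrow> (nat \<Rightarrow> real) \<Rightarrow> real \<Rightarrow> complex \<Rightarrow> nat \<Rightarrow> complex"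
  where "coupling C \<beta> h z j = of_real (C j * h powr \<beta> j) / (2 * \<i> * z)"

definition phase :: "real \<Rightarrow> complex \<Rightarrow> real \<Rightarrow> complex"
  where "phase h z l = exp (2 * \<i> * z * of_real l / of_real h)"

text \<open>
  Scattering data of the solution that is \<open>exp (- \<i> z y / h)\<close> to the left of all interactions.
  The jump condition at \<open>x j\<close> adds \<open>b j * exp (- 2 \<i> z (x j) / h)\<close> to the coefficient of the
  right-moving wave and subtracts \<open>b j\<close> from that of the left-moving one, where \<open>b j\<close> is the
  amplitude: the coupling times the incident wave, normalized by its left-moving phase. With
  \<open>E j k\<close> the phase gained between \<open>x k\<close> and \<open>x j\<close>, summing the earlier contributions gives the
  recursion.
\<close>
fun amplitude :: "(nat \<Rightarrow> complex) \<Rightarrow> (nat \<Rightarrow> nat \<Rightarrow> complex) \<Rightarrow> nat \<Rightarrow> complex"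
  where "amplitude a E j = a j * (1 + (\<Sum>k\<in>{1..<j}. amplitude a E k * (E j k - 1)))"

declare amplitude.simps [simp del]

text \<open>
  The left-moving coefficient to the right of all interactions, which is zero iff the solution
  described above is outgoing.
\<close>
definition secular :: "nat \<Rightarrow> (nat \<Rightarrow> complex) \<Rightarrow> (nat \<Rightarrow> nat \<Rightarrow> complex) \<Rightarrow> complex"
  where "secular N a E = 1 - (\<Sum>j\<in>{1..N}. amplitude a E j)"

lemma plane_wave_derivative:
  assumes "h > 0"
  shows "(plane_wave h z vp vm j has_vector_derivative
     \<i> * z / of_real h * (vp j * exp (\<i> * z * of_real y / of_real h)
                          - vm j * exp (- \<i> * z * of_real y / of_real h))) (at y)"
proof -
  have "((\<lambda>y. vp j * exp (\<i> * z * y / of_real h) + vm j * exp (- \<i> * z * y / of_real h))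
    has_field_derivative
     \<i> * z / of_real h * (vp j * exp (\<i> * z * of_real y / of_real h)
                          - vm j * exp (- \<i> * z * of_real y / of_real h))) (at (of_real y))"
    using assms by (auto intro!: derivative_eq_intros simp: field_simps)
  from has_vector_derivative_real_field[OF this] show ?thesis
    unfolding plane_wave_def by simp
qed

lemma secular_zero_imp_resonance:
  assumes h: "h > 0" and z: "z \<noteq> 0"
    and zero: "secular N (coupling C \<beta> h z) (\<lambda>j k. phase h z (x j - x k)) = 0"
  shows "is_resonance N x C \<beta> h z"
proof -
  define b where "b = amplitude (coupling C \<beta> h z) (\<lambda>j k. phase h z (x j - x k))"
  define e where "e = (\<lambda>y::real. exp (\<i> * z * of_real y / of_real h))"
  define vp where "vp = (\<lambda>j. \<Sum>k\<in>{1..j}. b k / (e (x k))\<^sup>2)"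
  define vm where "vm = (\<lambda>j. 1 - (\<Sum>k\<in>{1..j}. b k))"
  have e0: "e y \<noteq> 0" for y by (simp add: e_def)
  have e_minus: "exp (- \<i> * z * of_real y / of_real h) = 1 / e y"
    "exp (- (\<i> * z * of_real y / of_real h)) = 1 / e y" for y
    by (simp_all add: e_def exp_minus divide_inverse)
  have ph: "phase h z (y - y') = (e y)\<^sup>2 / (e y')\<^sup>2" for y y'
    by (simp add: phase_def e_def exp_diff diff_divide_distrib algebra_simps flip: exp_double)
  have pw: "plane_wave h z vp vm j y = vp j * e y + vm j / e y" for j y
    by (simp add: plane_wave_def e_minus) (simp add: e_def)
  have dpw: "vector_derivative (plane_wave h z vp vm j) (at y)
      = \<i> * z / of_real h * (vp j * e y - vm j / e y)" for j y
    using vector_derivative_at[OF plane_wave_derivative[OF h, of z vp vm j y]]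
    by (simp add: e_minus) (simp add: e_def)
  show ?thesis
    unfolding is_resonance_def
  proof (rule conjI[OF z], rule exI[of _ vp], rule exI[of _ vm], intro conjI ballI)
    show "\<exists>j\<le>N. vp j \<noteq> 0 \<or> vm j \<noteq> 0" by (rule exI[of _ 0]) (simp add: vm_def)
    show "vp 0 = 0" by (simp add: vp_def)
    show "vm N = 0" using zero by (simp add: vm_def b_def secular_def)
    fix j assume "j \<in> {1..N}"
    then obtain i where i: "j = Suc i" by (cases j) auto
    have vps: "vp j = vp i + b j / (e (x j))\<^sup>2" and vms: "vm j = vm i - b j"
      by (simp_all add: i vp_def vm_def)
    have cont: "plane_wave h z vp vm i (x j) = plane_wave h z vp vm j (x j)"
      unfolding pw vps vms using e0[of "x j"] by (simp add: field_simps power2_eq_square)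
    show "plane_wave h z vp vm (j - 1) (x j) = plane_wave h z vp vm j (x j)"
      using cont by (simp add: i)
    have "b j = coupling C \<beta> h z j * (1 + (\<Sum>k\<in>{1..<j}. b k * (phase h z (x j - x k) - 1)))"
      unfolding b_def by (subst amplitude.simps) simp
    also have "(\<Sum>k\<in>{1..<j}. b k * (phase h z (x j - x k) - 1))
        = (e (x j))\<^sup>2 * vp i - (\<Sum>k\<in>{1..i}. b k)"
      by (simp add: i atLeastLessThanSuc_atLeastAtMost vp_def ph sum_distrib_left
          right_diff_distrib sum_subtractf mult_ac)
    also have "1 + \<dots> = e (x j) * plane_wave h z vp vm i (x j)"
      unfolding pw using e0[of "x j"] by (simp add: vm_def field_simps power2_eq_square)
    finally have bj: "b j = coupling C \<beta> h z j * (e (x j) * plane_wave h z vp vm j (x j))"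
      by (simp add: cont)
    have "of_real (h\<^sup>2) * (vector_derivative (plane_wave h z vp vm (j - 1)) (at (x j))
            - vector_derivative (plane_wave h z vp vm j) (at (x j)))
        = - (2 * \<i> * z * of_real h) * b j / e (x j)"
    proof -
      have "j - 1 = i" by (simp add: i)
      thus ?thesis
        unfolding dpw using e0[of "x j"] h by (simp add: vps vms field_simps power2_eq_square)
    qed
    also have "\<dots> = - of_real (C j * h powr (1 + \<beta> j)) * plane_wave h z vp vm j (x j)"
      unfolding bj coupling_def using e0[of "x j"] h z
      by (simp add: powr_add field_simps)
    finally show "of_real (h\<^sup>2) * (vector_derivative (plane_wave h z vp vm (j - 1)) (at (x j))
            - vector_derivative (plane_wave h z vp vm j) (at (x j)))
        + of_real (C j * h powr (1 + \<beta> j)) * plane_wave h z vp vm j (x j) = 0"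
      by simp
  qed
qed

lemma continuous_on_amplitude:
  fixes a :: "'a::topological_space \<Rightarrow> nat \<Rightarrow> complex"
  assumes "\<And>j. continuous_on S (\<lambda>z. a z j)" and "\<And>j k. continuous_on S (\<lambda>z. E z j k)"
  shows "continuous_on S (\<lambda>z. amplitude (a z) (E z) j)"
proof (induction j rule: less_induct)
  case (less j)
  show ?case
    by (subst amplitude.simps) (auto intro!: continuous_intros assms less)
qed

lemma continuous_on_secular:
  fixes a :: "'a::topological_space \<Rightarrow> nat \<Rightarrow> complex"
  assumes "\<And>j. continuous_on S (\<lambda>z. a z j)" and "\<And>j k. continuous_on S (\<lambda>z. E z j k)"
  shows "continuous_on S (\<lambda>z. secular N (a z) (E z))"
  unfolding secular_def by (intro continuous_intros continuous_on_amplitude assms)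

lemma continuous_on_coupling:
  assumes "continuous_on S f" and "\<And>\<zeta>. \<zeta> \<in> S \<Longrightarrow> f \<zeta> \<noteq> 0"
  shows "continuous_on S (\<lambda>\<zeta>. coupling C \<beta> h (f \<zeta>) j)"
  unfolding coupling_def by (intro continuous_intros assms) (use assms in auto)

lemma continuous_on_phase:
  assumes "continuous_on S f"
  shows "continuous_on S (\<lambda>\<zeta>. phase h (f \<zeta>) l)"
  unfolding phase_def divide_inverse by (intro continuous_intros assms)

section \<open>Truncation of the secular function after the pair terms\<close>

text \<open>
  A discrete Gronwall estimate. The weights \<open>g\<close> turn the bound on the phases, a quotient
  \<open>g k / g j\<close>, into one with constant coefficients: the weighted partial sums grow by a factor
  \<open>1 + A * B\<close> in each step, plus the new term. Below, \<open>g j = h powr (2 * \<gamma> * x j)\<close> and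
  \<open>\<alpha> j = h powr \<beta> j\<close>.
\<close>
lemma amplitude_gronwall:
  fixes g \<alpha> :: "nat \<Rightarrow> real"
  assumes A: "A \<ge> 0" and B: "B \<ge> 0"
    and g: "\<And>j. g j > 0" and \<alpha>: "\<And>j. j \<in> {1..N} \<Longrightarrow> 0 \<le> \<alpha> j \<and> \<alpha> j \<le> 1"
    and a: "\<And>j. j \<in> {1..N} \<Longrightarrow> cmod (a j) \<le> A * \<alpha> j"
    and E: "\<And>j k. k \<in> {1..<j} \<Longrightarrow> j \<le> N \<Longrightarrow> cmod (E j k - 1) \<le> B * (g k / g j)"
  shows "j \<le> Suc N \<Longrightarrow> (\<Sum>k\<in>{1..<j}. cmod (amplitude a E k) * g k)
      \<le> A * (1 + A * B) ^ j * (\<Sum>k\<in>{1..<j}. \<alpha> k * g k)"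
proof (induction j)
  case (Suc j)
  show ?case
  proof (cases "j = 0")
    case False
    define S where "S = (\<Sum>k\<in>{1..<j}. cmod (amplitude a E k) * g k)"
    define s where "s = (\<Sum>k\<in>{1..<j}. \<alpha> k * g k)"
    have j: "j \<in> {1..N}" using Suc.prems False by auto
    have g0: "0 \<le> g k" for k using g[of k] by simp
    have S0: "S \<ge> 0" using g0 by (auto simp: S_def intro!: sum_nonneg)
    have IH: "S \<le> A * (1 + A * B) ^ j * s" using Suc by (simp add: S_def s_def)
    have "cmod (\<Sum>k\<in>{1..<j}. amplitude a E k * (E j k - 1))
        \<le> (\<Sum>k\<in>{1..<j}. cmod (amplitude a E k) * (B * (g k / g j)))"
      using j by (intro sum_norm_le) (simp add: norm_mult E mult_left_mono del: times_divide_eq_right)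
    also have "\<dots> = B / g j * S" by (simp add: S_def sum_distrib_left mult_ac)
    finally have "cmod (1 + (\<Sum>k\<in>{1..<j}. amplitude a E k * (E j k - 1))) \<le> 1 + B / g j * S"
      by (intro norm_triangle_le) simp
    hence "cmod (amplitude a E j) \<le> (A * \<alpha> j) * (1 + B / g j * S)"
      unfolding amplitude.simps[of a E j] norm_mult
      by (intro mult_mono a j) (use A \<alpha>[OF j] in auto)
    hence "cmod (amplitude a E j) * g j \<le> (A * \<alpha> j) * (1 + B / g j * S) * g j"
      using g[of j] by (intro mult_right_mono) auto
    also have "\<dots> = A * (\<alpha> j * g j) + (A * B * S) * \<alpha> j"
      using g[of j] by (simp add: field_simps)
    also have "(A * B * S) * \<alpha> j \<le> (A * B * S) * 1"
      using \<alpha>[OF j] A B S0 by (intro mult_left_mono) auto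
    finally have "S + cmod (amplitude a E j) * g j \<le> (1 + A * B) * S + A * (\<alpha> j * g j)"
      by (simp add: algebra_simps)
    also have "\<dots> \<le> (1 + A * B) * (A * (1 + A * B) ^ j * s) + A * (1 + A * B) ^ Suc j * (\<alpha> j * g j)"
    proof (intro add_mono mult_left_mono IH mult_right_mono)
      have "1 \<le> (1 + A * B) ^ Suc j" using A B by (intro one_le_power) auto
      hence "A * 1 \<le> A * (1 + A * B) ^ Suc j" using A by (intro mult_left_mono)
      thus "A \<le> A * (1 + A * B) ^ Suc j" by simp
    qed (use A B \<alpha>[OF j] g[of j] in auto)
    also have "\<dots> = A * (1 + A * B) ^ Suc j * (s + \<alpha> j * g j)" by (simp add: algebra_simps)
    finally show ?thesis using False by (simp add: S_def s_def atLeastLessThanSuc add.commute)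
  qed simp
qed simp

text \<open>
  Iterating the recursion twice leaves a sum over triples \<open>l < k < j\<close>. Each is a term of the outer
  pair \<open>(l, j)\<close>, of size at most \<open>T\<close>, times the coupling at \<open>k\<close>, of size at most \<open>\<epsilon>\<close>: inserting a
  third interaction inside an interval leaves the length of the path unchanged and costs a factor
  \<open>\<epsilon>\<close>. The single terms and the constant \<open>-1\<close> in \<open>E j k - 1\<close> are also of size \<open>\<epsilon>\<close>.
\<close>
lemma secular_pair_expansion:
  fixes g \<alpha> :: "nat \<Rightarrow> real"
  assumes A: "A \<ge> 0" and B: "B \<ge> 0"
    and g: "\<And>j. g j > 0" and \<alpha>: "\<And>j. j \<in> {1..N} \<Longrightarrow> 0 \<le> \<alpha> j \<and> \<alpha> j \<le> \<epsilon>"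
    and \<epsilon>: "\<epsilon> \<le> 1" and T: "T \<ge> 1"
    and a: "\<And>j. j \<in> {1..N} \<Longrightarrow> cmod (a j) \<le> A * \<alpha> j"
    and E: "\<And>j k. k \<in> {1..<j} \<Longrightarrow> j \<le> N \<Longrightarrow> cmod (E j k - 1) \<le> B * (g k / g j)"
    and pair: "\<And>j k. k \<in> {1..<j} \<Longrightarrow> j \<le> N \<Longrightarrow> \<alpha> k * \<alpha> j * (g k / g j) \<le> T"
  shows "cmod (secular N a E - (1 - (\<Sum>j\<in>{1..N}. \<Sum>k\<in>{1..<j}. a k * a j * E j k)))
     \<le> (real N * A + real N ^ 2 * A ^ 2 + real N ^ 3 * (A ^ 3 * B ^ 2 * (1 + A * B) ^ N)) * (\<epsilon> * T)"
proof (cases "N = 0")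
  case True
  thus ?thesis by (simp add: secular_def)
next
  case False
  hence N1: "1 \<in> {1..N}" by auto
  have \<epsilon>0: "\<epsilon> \<ge> 0" using \<alpha>[OF N1] by linarith
  have \<epsilon>T: "\<epsilon> \<le> \<epsilon> * T" using mult_left_mono[OF T \<epsilon>0] by simp
  have \<alpha>1: "0 \<le> \<alpha> j \<and> \<alpha> j \<le> 1" if "j \<in> {1..N}" for j using \<alpha>[OF that] \<epsilon> by auto
  have g0: "0 \<le> g k" for k using g[of k] by simp
  define P where "P = A * (1 + A * B) ^ N"
  have P: "P \<ge> 0" using A B by (simp add: P_def)
  define b where "b = amplitude a E"
  define d where "d = (\<lambda>k. b k - a k)"
  have b_eq: "b j = a j + a j * (\<Sum>k\<in>{1..<j}. b k * (E j k - 1))" for j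
    unfolding b_def by (subst amplitude.simps) (simp add: algebra_simps)
  have d_bound: "cmod (d k) \<le> A * B * P * (\<alpha> k / g k * (\<Sum>l\<in>{1..<k}. \<alpha> l * g l))"
    if k: "k \<in> {1..N}" for k
  proof -
    have "cmod (\<Sum>l\<in>{1..<k}. b l * (E k l - 1)) \<le> (\<Sum>l\<in>{1..<k}. cmod (b l) * (B * (g l / g k)))"
      using k by (intro sum_norm_le) (simp add: norm_mult E mult_left_mono del: times_divide_eq_right)
    also have "\<dots> = B / g k * (\<Sum>l\<in>{1..<k}. cmod (b l) * g l)"
      by (simp add: sum_distrib_left mult_ac)
    also have "\<dots> \<le> B / g k * (P * (\<Sum>l\<in>{1..<k}. \<alpha> l * g l))"
    proof (intro mult_left_mono)
      have nn: "0 \<le> (\<Sum>l\<in>{1..<k}. \<alpha> l * g l)"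
        using k \<alpha>1 g0 by (auto intro!: sum_nonneg)
      have "(\<Sum>l\<in>{1..<k}. cmod (b l) * g l) \<le> A * (1 + A * B) ^ k * (\<Sum>l\<in>{1..<k}. \<alpha> l * g l)"
        unfolding b_def using k by (intro amplitude_gronwall[OF A B g \<alpha>1 a E]) auto
      also have "\<dots> \<le> P * (\<Sum>l\<in>{1..<k}. \<alpha> l * g l)"
        unfolding P_def using k A B nn
        by (intro mult_right_mono mult_left_mono power_increasing) auto
      finally show "(\<Sum>l\<in>{1..<k}. cmod (b l) * g l) \<le> P * (\<Sum>l\<in>{1..<k}. \<alpha> l * g l)" .
    qed (use B g[of k] in auto)
    finally have "cmod (a k) * cmod (\<Sum>l\<in>{1..<k}. b l * (E k l - 1))
        \<le> (A * \<alpha> k) * (B / g k * (P * (\<Sum>l\<in>{1..<k}. \<alpha> l * g l)))"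
      using a[OF k] A \<alpha>1[OF k] by (intro mult_mono) auto
    thus ?thesis unfolding d_def using b_eq[of k] by (simp add: norm_mult mult_ac)
  qed
  \<comment> \<open>The weights at the middle index \<open>k\<close> cancel, which leaves the outer pair \<open>(l, j)\<close>.\<close>
  have triple: "cmod (a j * ((E j k - 1) * d k)) \<le> N * (A ^ 2 * B ^ 2 * P * (\<epsilon> * T))"
    if j: "j \<in> {1..N}" and k: "k \<in> {1..<j}" for j k
  proof -
    have kN: "k \<in> {1..N}" using j k by auto
    have "cmod (a j * ((E j k - 1) * d k)) \<le> (A * \<alpha> j) * ((B * (g k / g j)) *
        (A * B * P * (\<alpha> k / g k * (\<Sum>l\<in>{1..<k}. \<alpha> l * g l))))"
      unfolding norm_mult using j k kN A B \<alpha>1[OF j] g0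
      by (intro mult_mono a E d_bound) auto
    also have "\<dots> = A ^ 2 * B ^ 2 * P * (\<Sum>l\<in>{1..<k}. \<alpha> k * (\<alpha> l * \<alpha> j * (g l / g j)))"
      using g[of k] by (simp add: power2_eq_square sum_distrib_left mult_ac)
    also have "\<dots> \<le> A ^ 2 * B ^ 2 * P * (\<Sum>l\<in>{1..<k}. \<epsilon> * T)"
      using j k \<alpha>[OF kN] P \<epsilon>0 \<alpha>1 g0
      by (intro mult_left_mono sum_mono mult_mono pair) auto
    also have "\<dots> \<le> A ^ 2 * B ^ 2 * P * (N * (\<epsilon> * T))"
      using P \<epsilon>0 T k j by (intro mult_left_mono) (auto intro!: mult_right_mono)
    finally show ?thesis by (simp add: mult_ac)
  qed
  have eq: "secular N a E - (1 - (\<Sum>j\<in>{1..N}. \<Sum>k\<in>{1..<j}. a k * a j * E j k))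
      = (\<Sum>j\<in>{1..N}. - a j + ((\<Sum>k\<in>{1..<j}. a k * a j) - (\<Sum>k\<in>{1..<j}. a j * ((E j k - 1) * d k))))"
  proof -
    have "b j = a j + (\<Sum>k\<in>{1..<j}. a k * a j * E j k) - (\<Sum>k\<in>{1..<j}. a k * a j)
        + (\<Sum>k\<in>{1..<j}. a j * ((E j k - 1) * d k))" for j
      by (subst b_eq) (simp add: d_def algebra_simps sum_distrib_left sum.distrib sum_subtractf)
    thus ?thesis
      by (simp add: secular_def sum.distrib sum_subtractf sum_negf flip: b_def)
  qed
  have "cmod (secular N a E - (1 - (\<Sum>j\<in>{1..N}. \<Sum>k\<in>{1..<j}. a k * a j * E j k)))
      \<le> (\<Sum>j\<in>{1..N}. A * (\<epsilon> * T) + (N * (A ^ 2 * (\<epsilon> * T))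
      + N * (N * (A ^ 2 * B ^ 2 * P * (\<epsilon> * T)))))"
    unfolding eq
  proof (intro sum_norm_le norm_triangle_le add_mono order_trans[OF norm_triangle_ineq4])
    fix j assume j: "j \<in> {1..N}"
    have aj: "cmod (a j) \<le> A * \<epsilon>" if "j \<in> {1..N}" for j
      using a[OF that] \<alpha>[OF that] A by (meson mult_left_mono order_trans)
    have "cmod (- a j) \<le> A * \<epsilon>" using aj[OF j] by simp
    thus "cmod (- a j) \<le> A * (\<epsilon> * T)" using mult_left_mono[OF \<epsilon>T A] by linarith
    have "cmod (\<Sum>k\<in>{1..<j}. a k * a j) \<le> (\<Sum>k\<in>{1..<j}. A ^ 2 * (\<epsilon> * T))"
    proof (intro sum_norm_le)
      fix k assume k: "k \<in> {1..<j}"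
      hence kN: "k \<in> {1..N}" using j by auto
      have "cmod (a k * a j) \<le> (A * 1) * (A * \<epsilon>)"
        unfolding norm_mult using aj[OF kN] aj[OF j] A \<epsilon> \<epsilon>0
        by (intro mult_mono) (use order_trans[OF aj[OF kN] mult_left_mono[OF \<epsilon> A]] in auto)
      also have "\<dots> = A ^ 2 * \<epsilon>" by (simp add: power2_eq_square)
      also have "\<dots> \<le> A ^ 2 * (\<epsilon> * T)" by (rule mult_left_mono[OF \<epsilon>T]) simp
      finally show "cmod (a k * a j) \<le> A ^ 2 * (\<epsilon> * T)" .
    qed
    also have "\<dots> \<le> N * (A ^ 2 * (\<epsilon> * T))"
      using j \<epsilon>0 T by (auto intro!: mult_right_mono)
    finally show "cmod (\<Sum>k\<in>{1..<j}. a k * a j) \<le> N * (A ^ 2 * (\<epsilon> * T))" .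
    have "cmod (\<Sum>k\<in>{1..<j}. a j * ((E j k - 1) * d k))
        \<le> (\<Sum>k\<in>{1..<j}. N * (A ^ 2 * B ^ 2 * P * (\<epsilon> * T)))"
      using triple[OF j] by (intro sum_norm_le)
    also have "\<dots> \<le> N * (N * (A ^ 2 * B ^ 2 * P * (\<epsilon> * T)))"
      using j \<epsilon>0 T P by (auto intro!: mult_right_mono)
    finally show "cmod (\<Sum>k\<in>{1..<j}. a j * ((E j k - 1) * d k))
        \<le> N * (N * (A ^ 2 * B ^ 2 * P * (\<epsilon> * T)))" .
  qed
  also have "\<dots> = (real N * A + real N ^ 2 * A ^ 2 + real N ^ 3 * (A ^ 3 * B ^ 2 * (1 + A * B) ^ N)) * (\<epsilon> * T)"
    by (simp add: P_def power2_eq_square power3_eq_cube algebra_simps)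
  finally show ?thesis by simp
qed

section \<open>A perturbed exponential equation\<close>

text \<open>
  Brouwer's theorem applied to \<open>\<zeta> \<mapsto> Ln (1 + R \<zeta>) / (\<i> r)\<close>, which maps the unit disc to itself
  when \<open>R\<close> is small. Only continuity of \<open>R\<close> is involved, and the fixed point inherits the bound on
  the map.
\<close>
lemma exp_equation_perturbed:
  fixes R :: "complex \<Rightarrow> complex"
  assumes r: "r > 0" and cont: "continuous_on (cball 0 1) R"
    and R: "\<And>\<zeta>. \<zeta> \<in> cball 0 1 \<Longrightarrow> cmod (R \<zeta>) \<le> \<delta>"
    and \<delta>: "\<delta> < 1/2" "2 * \<delta> \<le> r"
  obtains \<zeta> where "cmod \<zeta> \<le> 2 * \<delta> / r" "cmod \<zeta> \<le> 1" "exp (\<i> * of_real r * \<zeta>) = 1 + R \<zeta>"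
proof -
  define f where "f = (\<lambda>\<zeta>. Ln (1 + R \<zeta>) / (\<i> * of_real r))"
  have Re_pos: "Re (1 + R \<zeta>) > 0" if "\<zeta> \<in> cball 0 1" for \<zeta>
    using abs_Re_le_cmod[of "R \<zeta>"] R[OF that] \<delta> by (simp add: abs_le_iff)
  have bound: "cmod (f \<zeta>) \<le> 2 * \<delta> / r" if "\<zeta> \<in> cball 0 1" for \<zeta>
  proof -
    have "cmod (Ln (1 + R \<zeta>)) \<le> 2 * cmod (R \<zeta>)"
      using R[OF that] \<delta> by (intro norm_Ln_le) auto
    hence "cmod (Ln (1 + R \<zeta>)) \<le> 2 * \<delta>" using R[OF that] by simp
    thus ?thesis using r by (simp add: f_def norm_divide norm_mult divide_right_mono)
  qed
  have le1: "2 * \<delta> / r \<le> 1" using \<delta> r by simp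
  obtain \<zeta> where \<zeta>: "\<zeta> \<in> cball 0 1" "f \<zeta> = \<zeta>"
  proof (rule brouwer_ball[of 1 0 f])
    show "continuous_on (cball 0 1) f"
      unfolding f_def
    proof (intro continuous_intros cont)
      show "1 + R \<zeta> \<notin> \<real>\<^sub>\<le>\<^sub>0" if "\<zeta> \<in> cball 0 1" for \<zeta>
        using Re_pos[OF that] by (auto simp: complex_nonpos_Reals_iff)
    qed (use r in auto)
    show "f \<in> cball 0 1 \<rightarrow> cball 0 1"
      using order_trans[OF bound le1] by auto
  qed (use that in auto)
  have "1 + R \<zeta> \<noteq> 0" using Re_pos[OF \<zeta>(1)] by (metis less_irrefl zero_complex.sel(1))
  hence "exp (\<i> * of_real r * f \<zeta>) = 1 + R \<zeta>" using r by (simp add: f_def)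
  thus ?thesis using that[of \<zeta>] bound[OF \<zeta>(1)] \<zeta> by simp
qed

section \<open>Leading part of the secular function\<close>

definition index_pairs :: "nat \<Rightarrow> (nat \<times> nat) set"
  where "index_pairs N = {(j, k). 1 \<le> j \<and> j < k \<and> k \<le> N}"

lemma finite_index_pairs: "finite (index_pairs N)"
  by (rule finite_subset[of _ "{1..N} \<times> {1..N}"]) (auto simp: index_pairs_def)

text \<open>
  Where a string with imaginary part \<open>- \<gamma> h log (1/h) + O(h)\<close> is sought. In this region the phase
  over a distance \<open>l\<close> has the size \<open>h powr (- 2 * \<gamma> * l)\<close> up to constants, and the couplings the
  size \<open>h powr \<beta> j\<close>.
\<close>
definition near_string :: "real \<Rightarrow> real \<Rightarrow> real \<Rightarrow> real \<Rightarrow> complex set"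
  where "near_string \<gamma> M W h =
    {z. 1 / M \<le> cmod z \<and> cmod z \<le> M \<and> \<bar>Im z + \<gamma> * h * ln (1 / h)\<bar> \<le> W * h}"

lemma norm_phase: "h > 0 \<Longrightarrow> cmod (phase h z l) = exp (- 2 * l * Im z / h)"
  by (simp add: phase_def norm_exp_eq_Re mult_ac)

lemma norm_phase_bounds:
  assumes h: "h > 0" and z: "z \<in> near_string \<gamma> M W h" and l: "0 \<le> l" "l \<le> X"
  shows "cmod (phase h z l) \<le> exp (2 * X * W) * h powr (- 2 * \<gamma> * l)"
    and "exp (- 2 * X * W) * h powr (- 2 * \<gamma> * l) \<le> cmod (phase h z l)"
proof -
  define t where "t = Im z / h + \<gamma> * ln (1 / h)"
  have "t * h = Im z + \<gamma> * h * ln (1 / h)" using h by (simp add: t_def field_simps)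
  moreover have "\<bar>t\<bar> * h = \<bar>t * h\<bar>" using h by (simp add: abs_mult)
  ultimately have "\<bar>t\<bar> * h \<le> W * h" using z by (simp add: near_string_def)
  hence t: "\<bar>t\<bar> \<le> W" using h by simp
  have "cmod (phase h z l) = exp (- (2 * l * t) + - 2 * \<gamma> * l * ln h)"
    using h by (simp add: norm_phase t_def ln_div algebra_simps)
  also have "\<dots> = exp (- (2 * l * t)) * h powr (- 2 * \<gamma> * l)"
    unfolding exp_add using h by (simp add: powr_def)
  finally have eq: "cmod (phase h z l) = exp (- (2 * l * t)) * h powr (- 2 * \<gamma> * l)" .
  have "\<bar>l * t\<bar> \<le> X * W"
    unfolding abs_mult using l t by (intro mult_mono) auto
  hence "- (2 * (l * t)) \<le> 2 * X * W" "- 2 * X * W \<le> - (2 * (l * t))" by linarith+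
  thus "cmod (phase h z l) \<le> exp (2 * X * W) * h powr (- 2 * \<gamma> * l)"
    and "exp (- 2 * X * W) * h powr (- 2 * \<gamma> * l) \<le> cmod (phase h z l)"
    unfolding eq by (auto intro!: mult_right_mono)
qed

lemma norm_coupling_bounds:
  assumes "h > 0" "M > 0" "z \<in> near_string \<gamma> M W h"
  shows "cmod (coupling C \<beta> h z j) \<le> M * \<bar>C j\<bar> * h powr \<beta> j"
    and "\<bar>C j\<bar> / (2 * M) * h powr \<beta> j \<le> cmod (coupling C \<beta> h z j)"
proof -
  have z: "1 / M \<le> cmod z" "cmod z \<le> M" using assms by (auto simp: near_string_def)
  hence z0: "cmod z > 0" using assms(2) by (meson divide_pos_pos less_le_trans zero_less_one)
  have eq: "cmod (coupling C \<beta> h z j) = \<bar>C j\<bar> * h powr \<beta> j * (1 / (2 * cmod z))"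
    by (simp add: coupling_def norm_divide norm_mult)
  have "1 \<le> M * cmod z" using z(1) assms(2) by (simp add: field_simps)
  hence "1 / (2 * cmod z) \<le> M" using z0 by (simp add: field_simps)
  hence "\<bar>C j\<bar> * h powr \<beta> j * (1 / (2 * cmod z)) \<le> \<bar>C j\<bar> * h powr \<beta> j * M"
    by (intro mult_left_mono) auto
  thus "cmod (coupling C \<beta> h z j) \<le> M * \<bar>C j\<bar> * h powr \<beta> j" unfolding eq by (simp add: mult_ac)
  have "1 / (2 * M) \<le> 1 / (2 * cmod z)" using z(2) z0 assms(2) by (simp add: field_simps)
  hence "\<bar>C j\<bar> * h powr \<beta> j * (1 / (2 * M)) \<le> \<bar>C j\<bar> * h powr \<beta> j * (1 / (2 * cmod z))"
    by (intro mult_left_mono) auto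
  thus "\<bar>C j\<bar> / (2 * M) * h powr \<beta> j \<le> cmod (coupling C \<beta> h z j)" unfolding eq by (simp add: mult_ac)
qed

locale point_interactions =
  fixes N :: nat and x C \<beta> :: "nat \<Rightarrow> real"
  assumes x_mono: "strict_mono_on {1..N} x"
    and C_nonzero: "\<And>j. j \<in> {1..N} \<Longrightarrow> C j \<noteq> 0"
    and \<beta>_pos: "\<And>j. j \<in> {1..N} \<Longrightarrow> \<beta> j > 0"
begin

text \<open>
  The exponent of \<open>h\<close> in the size of the term of a pair.
\<close>
definition weight :: "real \<Rightarrow> nat \<times> nat \<Rightarrow> real"
  where "weight \<gamma> = (\<lambda>(j, k). tilt \<gamma> (pair_point x \<beta> j k))"

lemma weight_eq: "weight \<gamma> (j, k) = \<beta> j + \<beta> k - 2 * \<gamma> * (x k - x j)"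
  by (simp add: weight_def tilt_def pair_point_def)

definition secular_function :: "real \<Rightarrow> complex \<Rightarrow> complex"
  where "secular_function h z = secular N (coupling C \<beta> h z) (\<lambda>j k. phase h z (x j - x k))"

text \<open>
  The absolute value makes the term symmetric in the two indices, so that two pairs with a common
  index can be compared without regard to the side on which that index lies.
\<close>
definition pair_term :: "real \<Rightarrow> complex \<Rightarrow> nat \<times> nat \<Rightarrow> complex"
  where "pair_term h z =
    (\<lambda>(j, k). coupling C \<beta> h z j * coupling C \<beta> h z k * phase h z \<bar>x k - x j\<bar>)"

lemma x_less: "(j, k) \<in> index_pairs N \<Longrightarrow> x j < x k"
  using x_mono by (auto simp: index_pairs_def strict_mono_on_def)

lemma norm_pair_term_bounds:
  assumes h: "h > 0" and M: "M > 0" and z: "z \<in> near_string \<gamma> M W h"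
    and jk: "(j, k) \<in> index_pairs N" and X: "x k - x j \<le> X"
  shows "cmod (pair_term h z (j, k))
      \<le> M * \<bar>C j\<bar> * (M * \<bar>C k\<bar>) * exp (2 * X * W) * h powr weight \<gamma> (j, k)"
    and "\<bar>C j\<bar> / (2 * M) * (\<bar>C k\<bar> / (2 * M)) * exp (- 2 * X * W) * h powr weight \<gamma> (j, k)
      \<le> cmod (pair_term h z (j, k))"
proof -
  note xl = x_less[OF jk]
  have l: "0 \<le> \<bar>x k - x j\<bar>" "\<bar>x k - x j\<bar> \<le> X" using X xl by auto
  have w: "h powr weight \<gamma> (j, k) = h powr \<beta> j * h powr \<beta> k * h powr (- 2 * \<gamma> * \<bar>x k - x j\<bar>)"
    using h xl by (simp add: weight_eq flip: powr_add)
  have "cmod (pair_term h z (j, k)) \<le> (M * \<bar>C j\<bar> * h powr \<beta> j) * (M * \<bar>C k\<bar> * h powr \<beta> k)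
      * (exp (2 * X * W) * h powr (- 2 * \<gamma> * \<bar>x k - x j\<bar>))"
    unfolding pair_term_def prod.case norm_mult
    using M by (intro mult_mono norm_coupling_bounds(1)[OF h M z] norm_phase_bounds(1)[OF h z l]) auto
  thus "cmod (pair_term h z (j, k))
      \<le> M * \<bar>C j\<bar> * (M * \<bar>C k\<bar>) * exp (2 * X * W) * h powr weight \<gamma> (j, k)"
    unfolding w by (simp only: mult_ac)
  have "(\<bar>C j\<bar> / (2 * M) * h powr \<beta> j) * (\<bar>C k\<bar> / (2 * M) * h powr \<beta> k)
      * (exp (- 2 * X * W) * h powr (- 2 * \<gamma> * \<bar>x k - x j\<bar>)) \<le> cmod (pair_term h z (j, k))"
    unfolding pair_term_def prod.case norm_mult
    using M by (intro mult_mono norm_coupling_bounds(2)[OF h M z] norm_phase_bounds(2)[OF h z l]) auto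
  thus "\<bar>C j\<bar> / (2 * M) * (\<bar>C k\<bar> / (2 * M)) * exp (- 2 * X * W) * h powr weight \<gamma> (j, k)
      \<le> cmod (pair_term h z (j, k))"
    unfolding w by (simp only: mult_ac)
qed

lemma sum_pair_terms:
  "(\<Sum>j\<in>{1..N}. \<Sum>k\<in>{1..<j}. coupling C \<beta> h z k * coupling C \<beta> h z j * phase h z (x j - x k))
     = (\<Sum>p\<in>index_pairs N. pair_term h z p)"
proof -
  have "(\<Sum>j\<in>{1..N}. \<Sum>k\<in>{1..<j}. coupling C \<beta> h z k * coupling C \<beta> h z j * phase h z (x j - x k))
     = (\<Sum>(j, k)\<in>Sigma {1..N} (\<lambda>j. {1..<j}).
          coupling C \<beta> h z k * coupling C \<beta> h z j * phase h z (x j - x k))"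
    by (rule sum.Sigma) auto
  also have "\<dots> = (\<Sum>p\<in>index_pairs N. pair_term h z p)"
  proof (rule sum.reindex_bij_witness[of _ prod.swap prod.swap])
    fix p assume p: "p \<in> Sigma {1..N} (\<lambda>j. {1..<j})"
    thus "prod.swap p \<in> index_pairs N" by (auto simp: index_pairs_def)
    then show "pair_term h z (prod.swap p) = (case p of (j, k) \<Rightarrow>
        coupling C \<beta> h z k * coupling C \<beta> h z j * phase h z (x j - x k))"
      using x_less[of "snd p" "fst p"] by (cases p) (simp add: pair_term_def)
  qed (auto simp: index_pairs_def)
  finally show ?thesis .
qed

text \<open>
  With \<open>\<mu>\<close> the height of the supporting line of slope \<open>\<gamma>\<close>, only the terms whose points are on that
  line have the full size \<open>h powr \<mu>\<close>. The constant 1 belongs to the origin, hence is leading iff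
  \<open>\<mu> = 0\<close>. The gain \<open>\<eta>\<close> is limited by the exponents \<open>\<beta> j\<close> and by the gaps between \<open>\<mu>\<close> and
  the heights of the other points, the origin included.
\<close>
lemma secular_leading_part:
  assumes \<gamma>: "\<gamma> > 0" and M: "M > 0" and W: "W \<ge> 0" and \<mu>: "\<mu> \<le> 0"
    and min: "\<forall>p\<in>index_pairs N. \<mu> \<le> weight \<gamma> p"
  shows "\<exists>K\<ge>0. \<exists>\<eta>>0. \<forall>h z. 0 < h \<and> h < 1 \<and> z \<in> near_string \<gamma> M W h \<longrightarrow>
       cmod (secular_function h z - ((if \<mu> = 0 then 1 else 0)
         - (\<Sum>p | p \<in> index_pairs N \<and> weight \<gamma> p = \<mu>. pair_term h z p))) \<le> K * h powr (\<mu> + \<eta>)"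
proof -
  define I where "I = index_pairs N"
  define I0 where "I0 = {p \<in> I. weight \<gamma> p = \<mu>}"
  define G where "G = insert 1 (\<beta> ` {1..N} \<union> (\<lambda>p. weight \<gamma> p - \<mu>) ` (I - I0)
    \<union> (if \<mu> = 0 then {} else {- \<mu>}))"
  define \<eta> where "\<eta> = Min G"
  have finI: "finite I" by (simp add: I_def finite_index_pairs)
  have finG: "finite G" using finI by (simp add: G_def)
  have "weight \<gamma> p - \<mu> > 0" if "p \<in> I - I0" for p
    using bspec[OF min, of p] that by (simp add: I_def I0_def less_le)
  hence "\<forall>g\<in>G. g > 0"
    using \<beta>_pos \<mu> unfolding G_def by (auto split: if_splits)
  hence \<eta>: "\<eta> > 0" unfolding \<eta>_def using finG by (subst Min_gr_iff) (auto simp: G_def)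
  have \<eta>_le: "\<eta> \<le> g" if "g \<in> G" for g using that finG by (simp add: \<eta>_def)
  \<comment> \<open>An upper bound on all distances.\<close>
  define X where "X = 2 * (\<Sum>j\<in>{1..N}. \<bar>x j\<bar>)"
  have X: "x j - x k \<le> X" if "j \<in> {1..N}" "k \<in> {1..N}" for j k
  proof -
    have "\<bar>x i\<bar> \<le> (\<Sum>j\<in>{1..N}. \<bar>x j\<bar>)" if "i \<in> {1..N}" for i
      using that by (intro member_le_sum) auto
    from this[OF that(1)] this[OF that(2)] show ?thesis unfolding X_def by linarith
  qed
  define A where "A = M * (\<Sum>j\<in>{1..N}. \<bar>C j\<bar>)"
  have A0: "A \<ge> 0" using M by (auto simp: A_def intro!: sum_nonneg mult_nonneg_nonneg)
  have A: "M * \<bar>C j\<bar> \<le> A" if "j \<in> {1..N}" for j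
    unfolding A_def using that M by (intro mult_left_mono member_le_sum) auto
  define B where "B = exp (2 * X * W) + 1"
  have B0: "B \<ge> 0" by (simp add: B_def add_nonneg_nonneg)
  define K1 where "K1 = real N * A + real N ^ 2 * A ^ 2 + real N ^ 3 * (A ^ 3 * B ^ 2 * (1 + A * B) ^ N)"
  define K2 where "K2 = card I * (A * A * exp (2 * X * W))"
  have K12: "K1 \<ge> 0" "K2 \<ge> 0" using A0 B0 by (auto simp: K1_def K2_def)
  have bound: "cmod (secular_function h z - ((if \<mu> = 0 then 1 else 0) - (\<Sum>p\<in>I0. pair_term h z p)))
      \<le> (K1 + (1 + K2)) * h powr (\<mu> + \<eta>)"
    if h: "0 < h" "h < 1" and z: "z \<in> near_string \<gamma> M W h" for h z
  proof -
    have mono: "h powr s \<le> h powr t" if "t \<le> s" for s t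
      using that h by (intro powr_mono') auto
    define S where "S = (\<Sum>p\<in>I. pair_term h z p)"
    have "cmod (secular_function h z - (1 - S)) \<le> K1 * (h powr \<eta> * h powr \<mu>)"
      unfolding secular_function_def S_def I_def sum_pair_terms[symmetric] K1_def
    proof (rule secular_pair_expansion[where g = "\<lambda>j. h powr (2 * \<gamma> * x j)" and \<alpha> = "\<lambda>j. h powr \<beta> j"])
      show "0 \<le> h powr \<beta> j \<and> h powr \<beta> j \<le> h powr \<eta>" if "j \<in> {1..N}" for j
        using that by (auto intro!: mono \<eta>_le simp: G_def)
      show "h powr \<eta> \<le> 1" using mono[of 0 \<eta>] \<eta> h by simp
      show "1 \<le> h powr \<mu>" using mono[of \<mu> 0] \<mu> h by simp
      show "cmod (coupling C \<beta> h z j) \<le> A * h powr \<beta> j" if "j \<in> {1..N}" for j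
        using norm_coupling_bounds(1)[OF h(1) M z, where C = C and \<beta> = \<beta> and j = j] mult_right_mono[OF A[OF that], of "h powr \<beta> j"]
        by simp
      fix j k assume jk: "k \<in> {1..<j}" "j \<le> N"
      hence pr: "(k, j) \<in> index_pairs N" by (auto simp: index_pairs_def)
      have quot: "h powr (2 * \<gamma> * x k) / h powr (2 * \<gamma> * x j) = h powr (- 2 * \<gamma> * (x j - x k))"
        by (simp only: powr_diff[symmetric]) (simp add: algebra_simps)
      have "1 \<le> h powr (- 2 * \<gamma> * (x j - x k))"
        using mono[of "- 2 * \<gamma> * (x j - x k)" 0] x_less[OF pr] \<gamma> h by simp
      moreover have "cmod (phase h z (x j - x k)) \<le> exp (2 * X * W) * h powr (- 2 * \<gamma> * (x j - x k))"
        using x_less[OF pr] jk by (intro norm_phase_bounds[OF h(1) z] X) auto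
      ultimately show "cmod (phase h z (x j - x k) - 1)
          \<le> B * (h powr (2 * \<gamma> * x k) / h powr (2 * \<gamma> * x j))"
        unfolding quot B_def using norm_triangle_ineq4[of "phase h z (x j - x k)" 1]
        by (simp add: algebra_simps)
      have "h powr \<beta> k * h powr \<beta> j * h powr (- 2 * \<gamma> * (x j - x k)) = h powr weight \<gamma> (k, j)"
        using h by (simp add: weight_eq flip: powr_add)
      thus "h powr \<beta> k * h powr \<beta> j * (h powr (2 * \<gamma> * x k) / h powr (2 * \<gamma> * x j)) \<le> h powr \<mu>"
        unfolding quot using mono[OF bspec[OF min pr]] by simp
    qed (use A0 B0 h in auto)
    hence 1: "cmod (secular_function h z - (1 - S)) \<le> K1 * h powr (\<mu> + \<eta>)"
      by (simp add: powr_add mult_ac)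
    have 2: "cmod (\<Sum>p\<in>I - I0. pair_term h z p) \<le> K2 * h powr (\<mu> + \<eta>)"
    proof -
      have "cmod (\<Sum>p\<in>I - I0. pair_term h z p) \<le> (\<Sum>p\<in>I - I0. A * A * exp (2 * X * W) * h powr (\<mu> + \<eta>))"
      proof (rule sum_norm_le)
        fix p assume p: "p \<in> I - I0"
        obtain j k where [simp]: "p = (j, k)" by (cases p)
        have jk: "(j, k) \<in> index_pairs N" "j \<in> {1..N}" "k \<in> {1..N}"
          using p by (auto simp: I_def index_pairs_def)
        have "\<eta> \<le> weight \<gamma> p - \<mu>" using p by (intro \<eta>_le) (auto simp: G_def)
        hence "h powr weight \<gamma> p \<le> h powr (\<mu> + \<eta>)" by (intro mono) simp
        moreover have "cmod (pair_term h z p)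
            \<le> M * \<bar>C j\<bar> * (M * \<bar>C k\<bar>) * exp (2 * X * W) * h powr weight \<gamma> p"
          using norm_pair_term_bounds(1)[OF h(1) M z jk(1)] X jk by simp
        moreover have "\<dots> \<le> A * A * exp (2 * X * W) * h powr weight \<gamma> p"
          using A0 jk M by (intro mult_right_mono mult_mono A) auto
        ultimately show "cmod (pair_term h z p) \<le> A * A * exp (2 * X * W) * h powr (\<mu> + \<eta>)"
          using A0 by (meson exp_ge_zero mult_left_mono mult_nonneg_nonneg order_trans)
      qed
      also have "\<dots> \<le> K2 * h powr (\<mu> + \<eta>)"
      proof -
        have "real (card (I - I0)) \<le> real (card I)" using finI by (simp add: card_mono)
        hence "real (card (I - I0)) * (A * A * exp (2 * X * W) * h powr (\<mu> + \<eta>))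
            \<le> real (card I) * (A * A * exp (2 * X * W) * h powr (\<mu> + \<eta>))"
          using A0 by (intro mult_right_mono) auto
        thus ?thesis by (simp add: K2_def mult.assoc)
      qed
      finally show ?thesis .
    qed
    have 3: "cmod (1 - (if \<mu> = 0 then 1 else 0)) \<le> h powr (\<mu> + \<eta>)"
    proof (cases "\<mu> = 0")
      case False
      hence "\<eta> \<le> - \<mu>" by (intro \<eta>_le) (auto simp: G_def)
      hence "h powr 0 \<le> h powr (\<mu> + \<eta>)" by (intro mono) simp
      thus ?thesis using False h by simp
    qed simp
    have S: "S = (\<Sum>p\<in>I0. pair_term h z p) + (\<Sum>p\<in>I - I0. pair_term h z p)"
      unfolding S_def using finI by (subst sum.subset_diff[of I0]) (auto simp: I0_def add.commute)
    have "secular_function h z - ((if \<mu> = 0 then 1 else 0) - (\<Sum>p\<in>I0. pair_term h z p))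
        = (secular_function h z - (1 - S)) + ((1 - (if \<mu> = 0 then 1 else 0)) - (\<Sum>p\<in>I - I0. pair_term h z p))"
      unfolding S by simp
    also have "cmod \<dots> \<le> K1 * h powr (\<mu> + \<eta>) + (h powr (\<mu> + \<eta>) + K2 * h powr (\<mu> + \<eta>))"
      by (intro norm_triangle_le add_mono 1 order_trans[OF norm_triangle_ineq4] 2 3)
    finally show ?thesis by (simp add: algebra_simps)
  qed
  have "K1 + (1 + K2) \<ge> 0" using K12 by simp
  thus ?thesis using \<eta> bound unfolding I0_def I_def mem_Collect_eq by blast
qed

section \<open>Zeros of the secular function\<close>

text \<open>
  If near \<open>z0\<close> the secular function is \<open>T \<zeta> * (1 - exp (2 \<i> \<Delta> \<zeta>))\<close> up to a small relative
  error, with \<open>z = z0 + h \<zeta>\<close>, then it vanishes near \<open>\<zeta> = 0\<close>.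
\<close>
lemma resonance_near:
  assumes h: "h > 0" and \<Delta>: "\<Delta> > 0" and \<delta>: "\<delta> < 1/2" "\<delta> \<le> \<Delta>"
    and nz: "\<And>\<zeta>. \<zeta> \<in> cball 0 1 \<Longrightarrow> z0 + of_real h * \<zeta> \<noteq> 0"
    and T: "continuous_on (cball 0 1) T" "\<And>\<zeta>. \<zeta> \<in> cball 0 1 \<Longrightarrow> T \<zeta> \<noteq> 0"
    and est: "\<And>\<zeta>. \<zeta> \<in> cball 0 1 \<Longrightarrow>
      cmod (secular_function h (z0 + of_real h * \<zeta>) / T \<zeta> + exp (2 * \<i> * of_real \<Delta> * \<zeta>) - 1) \<le> \<delta>"
  obtains z where "is_resonance N x C \<beta> h z" "cmod (z - z0) \<le> h * (\<delta> / \<Delta>)"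
proof -
  define R where "R = (\<lambda>\<zeta>. secular_function h (z0 + of_real h * \<zeta>) / T \<zeta> + exp (2 * \<i> * of_real \<Delta> * \<zeta>) - 1)"
  have "continuous_on (cball 0 1) R"
    unfolding R_def secular_function_def
    by (intro continuous_intros continuous_on_secular continuous_on_coupling continuous_on_phase T nz)
       (use T in auto)
  moreover have "cmod (R \<zeta>) \<le> \<delta>" if "\<zeta> \<in> cball 0 1" for \<zeta>
    using est[OF that] by (simp add: R_def)
  ultimately obtain \<zeta> where \<zeta>: "cmod \<zeta> \<le> 2 * \<delta> / (2 * \<Delta>)" "cmod \<zeta> \<le> 1"
    "exp (\<i> * of_real (2 * \<Delta>) * \<zeta>) = 1 + R \<zeta>"
    using exp_equation_perturbed[of "2 * \<Delta>" R \<delta>] \<Delta> \<delta> by auto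
  have \<zeta>1: "\<zeta> \<in> cball 0 1" using \<zeta> by simp
  have "secular_function h (z0 + of_real h * \<zeta>) = 0"
    using \<zeta>(3) T(2)[OF \<zeta>1] by (simp add: R_def mult_ac)
  hence "is_resonance N x C \<beta> h (z0 + of_real h * \<zeta>)"
    unfolding secular_function_def using nz[OF \<zeta>1] h by (intro secular_zero_imp_resonance)
  moreover have "cmod (z0 + of_real h * \<zeta> - z0) \<le> h * (\<delta> / \<Delta>)"
    using mult_left_mono[OF \<zeta>(1), of h] h by (simp add: norm_mult)
  ultimately show ?thesis using that by blast
qed

end

context point_interactions
begin

section \<open>Minimizing pairs\<close>

lemma newton_points_eq:
  "newton_points N x \<beta> = insert (0, 0) ((\<lambda>(j, k). pair_point x \<beta> j k) ` index_pairs N)"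
  by (auto simp: newton_points_def index_pairs_def)

lemma tilt_minimal_iff:
  "(\<forall>p\<in>newton_points N x \<beta>. \<mu> \<le> tilt \<gamma> p) \<longleftrightarrow> \<mu> \<le> 0 \<and> (\<forall>p\<in>index_pairs N. \<mu> \<le> weight \<gamma> p)"
  by (auto simp: newton_points_eq weight_def tilt_def)

lemma weight_gamma_sum:
  assumes "(j, k) \<in> index_pairs N"
  shows "0 \<le> weight \<gamma> (j, k) \<longleftrightarrow> \<gamma> \<le> gamma_sum x \<beta> j k"
    and "weight \<gamma> (j, k) = 0 \<longleftrightarrow> \<gamma> = gamma_sum x \<beta> j k"
  using x_less[OF assms] by (auto simp: weight_eq gamma_sum_def field_simps)

lemma dominant_pair_iff:
  assumes "(j, k) \<in> index_pairs N"
  shows "dominant_pair N x \<beta> j k \<longleftrightarrow> (\<forall>p\<in>index_pairs N. 0 \<le> weight (gamma_sum x \<beta> j k) p)"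
proof -
  have "(\<forall>p\<in>index_pairs N. 0 \<le> weight (gamma_sum x \<beta> j k) p)
      \<longleftrightarrow> (\<forall>p\<in>index_pairs N. gamma_sum x \<beta> j k \<le> gamma_sum x \<beta> (fst p) (snd p))"
    using weight_gamma_sum(1) by (intro ball_cong) auto
  thus ?thesis using assms by (auto simp: dominant_pair_def index_pairs_def)
qed

lemma weight_exchange: "weight \<gamma> (a, d) + weight \<gamma> (c, b) = weight \<gamma> (a, b) + weight \<gamma> (c, d)"
  by (simp add: weight_eq algebra_simps)

text \<open>
  Two minimizing intervals cannot be ordered one after the other, since the interval spanning both
  would weigh less. Hence exchanging their right ends gives two further minimizing pairs, and all
  these points are on one supporting line.
\<close>
lemma minimizing_pairs_share_index:
  assumes uniq: "slopes_unique N x \<beta>" and \<gamma>: "\<gamma> > 0" and \<mu>: "\<mu> \<le> 0"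
    and min: "\<forall>p\<in>index_pairs N. \<mu> \<le> weight \<gamma> p"
    and ab: "(a, b) \<in> index_pairs N" "weight \<gamma> (a, b) = \<mu>"
    and cd: "(c, d) \<in> index_pairs N" "weight \<gamma> (c, d) = \<mu>"
  shows "a = c \<or> b = d"
proof (rule ccontr)
  assume neq: "\<not> (a = c \<or> b = d)"
  \<comment> \<open>Otherwise \<open>(a', d')\<close> would weigh at most \<open>2 * \<mu>\<close> minus the positive \<open>\<beta> b' + \<beta> c'\<close>.\<close>
  have overlap: "c' < b'"
    if "(a', b') \<in> index_pairs N" "weight \<gamma> (a', b') = \<mu>"
      "(c', d') \<in> index_pairs N" "weight \<gamma> (c', d') = \<mu>" for a' b' c' d'
  proof (rule ccontr)
    assume le: "\<not> c' < b'"
    have in_range: "b' \<in> {1..N}" "c' \<in> {1..N}" using that by (auto simp: index_pairs_def)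
    have "x b' \<le> x c'"
      using le in_range strict_mono_on_leD[OF x_mono] by simp
    hence "0 \<le> 2 * \<gamma> * (x c' - x b')" using \<gamma> by simp
    moreover have "weight \<gamma> (a', b') + weight \<gamma> (c', d')
        = weight \<gamma> (a', d') + (\<beta> b' + \<beta> c' + 2 * \<gamma> * (x c' - x b'))"
      by (simp add: weight_eq algebra_simps)
    moreover have "(a', d') \<in> index_pairs N" using that le by (auto simp: index_pairs_def)
    ultimately show False
      using that \<mu> bspec[OF min, of "(a', d')"] \<beta>_pos[OF in_range(1)] \<beta>_pos[OF in_range(2)] by linarith
  qed
  have ad: "(a, d) \<in> index_pairs N" and cb: "(c, b) \<in> index_pairs N"
    using overlap[OF ab cd] overlap[OF cd ab] ab cd by (auto simp: index_pairs_def)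
  have w: "weight \<gamma> (a, d) = \<mu>" "weight \<gamma> (c, b) = \<mu>"
    using weight_exchange[of \<gamma> a d c b] bspec[OF min ad] bspec[OF min cb] ab(2) cd(2) by linarith+
  have xs: "x a \<noteq> x c" "x b \<noteq> x d"
    using neq ab cd strict_mono_on_imp_inj_on[OF x_mono] by (auto simp: index_pairs_def inj_on_eq_iff)
  have tmin: "\<And>p. p \<in> newton_points N x \<beta> \<Longrightarrow> \<mu> \<le> tilt \<gamma> p"
    using tilt_minimal_iff min \<mu> by blast
  have mem: "pair_point x \<beta> j k \<in> newton_points N x \<beta>" if "(j, k) \<in> index_pairs N" for j k
    using that by (force simp: newton_points_eq)
  have t: "tilt \<gamma> (pair_point x \<beta> j k) = \<mu>" if "weight \<gamma> (j, k) = \<mu>" for j k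
    using that by (simp add: weight_def)
  have f: "fst (pair_point x \<beta> j k) = 2 * (x k - x j)" for j k by (simp add: pair_point_def)
  have "fst (pair_point x \<beta> a b) \<noteq> fst (pair_point x \<beta> a d)" using xs by (simp add: f)
  note three = no_three_minimizers[OF uniq tmin _ t[OF ab(2)] t[OF w(1)] _ this]
  \<comment> \<open>Of the points \<open>(c, b)\<close> and \<open>(c, d)\<close>, at least one differs from \<open>(a, b)\<close> and \<open>(a, d)\<close>.\<close>
  show False
  proof (cases "x d - x a = x b - x c")
    case False
    have "fst (pair_point x \<beta> a b) \<noteq> fst (pair_point x \<beta> c b)" using xs by (simp add: f)
    moreover have "fst (pair_point x \<beta> a d) \<noteq> fst (pair_point x \<beta> c b)" using False by (simp add: f)
    ultimately show False
      using three[OF _ _ t[OF w(2)]] mem[OF ab(1)] mem[OF ad] mem[OF cb] by blast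
  next
    case True
    have "x b - x a \<noteq> x d - x c" using True xs by auto
    hence "fst (pair_point x \<beta> a b) \<noteq> fst (pair_point x \<beta> c d)" by (simp add: f)
    moreover have "fst (pair_point x \<beta> a d) \<noteq> fst (pair_point x \<beta> c d)" using xs by (simp add: f)
    ultimately show False
      using three[OF _ _ t[OF cd(2)]] mem[OF ab(1)] mem[OF ad] mem[OF cd(1)] by blast
  qed
qed

lemma minimizing_pairs_points_distinct:
  assumes "slopes_unique N x \<beta>" "\<gamma> > 0" "\<mu> \<le> 0" "\<forall>p\<in>index_pairs N. \<mu> \<le> weight \<gamma> p"
    and "(a, b) \<in> index_pairs N" "weight \<gamma> (a, b) = \<mu>"
    and "(c, d) \<in> index_pairs N" "weight \<gamma> (c, d) = \<mu>"
    and neq: "(a, b) \<noteq> (c, d)"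
  shows "fst (pair_point x \<beta> a b) \<noteq> fst (pair_point x \<beta> c d)"
proof -
  have inj: "x i = x i' \<longleftrightarrow> i = i'" if "i \<in> {1..N}" "i' \<in> {1..N}" for i i'
    using strict_mono_on_imp_inj_on[OF x_mono] that by (rule inj_on_eq_iff)
  from minimizing_pairs_share_index[OF assms(1-8)] show ?thesis
    using neq assms(5,7) inj[of a c] inj[of b d] by (auto simp: pair_point_def index_pairs_def)
qed

lemma minimizing_pair_unique:
  assumes uniq: "slopes_unique N x \<beta>" and \<gamma>: "\<gamma> > 0"
    and min: "\<forall>p\<in>index_pairs N. 0 \<le> weight \<gamma> p"
    and p: "p \<in> index_pairs N" "weight \<gamma> p = 0" and q: "q \<in> index_pairs N" "weight \<gamma> q = 0"
  shows "p = q"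
proof (rule ccontr)
  assume "p \<noteq> q"
  obtain a b c d where [simp]: "p = (a, b)" "q = (c, d)" by (cases p; cases q)
  have neq: "(a, b) \<noteq> (c, d)" using \<open>p \<noteq> q\<close> by simp
  have tmin: "\<And>p. p \<in> newton_points N x \<beta> \<Longrightarrow> 0 \<le> tilt \<gamma> p"
    using tilt_minimal_iff[of 0 \<gamma>] min by blast
  have pts: "{(0, 0), pair_point x \<beta> a b, pair_point x \<beta> c d} \<subseteq> newton_points N x \<beta>"
    using p q by (force simp: newton_points_eq)
  have "fst (pair_point x \<beta> a b) \<noteq> fst (pair_point x \<beta> c d)"
    using minimizing_pairs_points_distinct[OF uniq \<gamma> order_refl min] p q neq by simp
  moreover have "0 < fst (pair_point x \<beta> a b)" "0 < fst (pair_point x \<beta> c d)"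
    using x_less p q by (auto simp: pair_point_def)
  moreover have "tilt \<gamma> (pair_point x \<beta> a b) = 0" "tilt \<gamma> (pair_point x \<beta> c d) = 0"
    using p q by (auto simp: weight_def)
  ultimately show False
    by (intro no_three_minimizers[OF uniq tmin pts]) (auto simp: tilt_def)
qed

text \<open>
  Distinct minimizing pairs have distinct points, so the standing assumption on points carries over
  to pairs of indices.
\<close>
lemma at_most_two_minimizing_pairs:
  assumes uniq: "slopes_unique N x \<beta>" and \<gamma>: "\<gamma> > 0" and \<mu>: "\<mu> \<le> 0"
    and min: "\<forall>p\<in>index_pairs N. \<mu> \<le> weight \<gamma> p"
    and p: "p \<in> index_pairs N" "weight \<gamma> p = \<mu>" and q: "q \<in> index_pairs N" "weight \<gamma> q = \<mu>"
    and r: "r \<in> index_pairs N" "weight \<gamma> r = \<mu>" and neq: "p \<noteq> q"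
  shows "r = p \<or> r = q"
proof (rule ccontr)
  assume r_neq: "\<not> (r = p \<or> r = q)"
  obtain a b c d e f where [simp]: "p = (a, b)" "q = (c, d)" "r = (e, f)"
    by (cases p; cases q; cases r)
  have tmin: "\<And>p. p \<in> newton_points N x \<beta> \<Longrightarrow> \<mu> \<le> tilt \<gamma> p"
    using tilt_minimal_iff[of \<mu> \<gamma>] min \<mu> by blast
  have pts: "{pair_point x \<beta> a b, pair_point x \<beta> c d, pair_point x \<beta> e f} \<subseteq> newton_points N x \<beta>"
    using p q r by (force simp: newton_points_eq)
  note distinct = minimizing_pairs_points_distinct[OF uniq \<gamma> \<mu> min]
  show False
    by (rule no_three_minimizers[OF uniq tmin pts])
       (use p q r neq r_neq distinct[of a b c d] distinct[of a b e f] distinct[of c d e f] in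
         \<open>auto simp: weight_def\<close>)
qed

text \<open>
  The origin is a point of the polygon, so a supporting line has height \<open>\<mu> \<le> 0\<close>. It passes through
  a point of positive abscissa and positive ordinate, which makes its slope positive.
\<close>
lemma newton_edge_minimizers:
  assumes edge: "newton_edge N x \<beta> p q" and \<gamma>: "\<gamma> = slope p q"
  obtains \<mu> where "\<gamma> > 0" "\<mu> \<le> 0" "\<forall>r\<in>index_pairs N. \<mu> \<le> weight \<gamma> r"
    "tilt \<gamma> p = \<mu>" "tilt \<gamma> q = \<mu>"
    "p = (0, 0) \<or> (\<exists>a b. (a, b) \<in> index_pairs N \<and> p = pair_point x \<beta> a b)"
    "\<exists>c d. (c, d) \<in> index_pairs N \<and> q = pair_point x \<beta> c d"
proof -
  have lt: "fst p < fst q" using edge by (simp add: newton_edge_def)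
  have tq: "tilt \<gamma> q = tilt \<gamma> p" using tilt_slope[OF lt] \<gamma> by simp
  have min: "\<forall>r\<in>newton_points N x \<beta>. tilt \<gamma> p \<le> tilt \<gamma> r"
    using newton_edge_supports[OF edge] newton_points_subset_polygon \<gamma> by blast
  hence min': "tilt \<gamma> p \<le> 0" "\<And>r. r \<in> index_pairs N \<Longrightarrow> tilt \<gamma> p \<le> weight \<gamma> r"
    by (auto simp: tilt_minimal_iff)
  have p: "p = (0, 0) \<or> (\<exists>a b. (a, b) \<in> index_pairs N \<and> p = pair_point x \<beta> a b)"
    and q: "q = (0, 0) \<or> (\<exists>c d. (c, d) \<in> index_pairs N \<and> q = pair_point x \<beta> c d)"
    using newton_edge_endpoints[OF edge] by (auto simp: newton_points_eq)
  have "0 \<le> fst p" using p x_less by (fastforce simp: pair_point_def)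
  then obtain c d where cd: "(c, d) \<in> index_pairs N" "q = pair_point x \<beta> c d"
    using q lt by auto
  have "\<beta> c + \<beta> d \<le> \<gamma> * (2 * (x d - x c))"
    using tq min'(1) by (simp add: cd(2) tilt_def pair_point_def)
  moreover have "0 < \<beta> c + \<beta> d" using cd(1) \<beta>_pos by (auto simp: index_pairs_def add_pos_pos)
  ultimately have "0 < \<gamma> * (2 * (x d - x c))" by linarith
  hence "\<gamma> > 0" using x_less[OF cd(1)] by (simp add: zero_less_mult_iff)
  thus ?thesis using that[of "tilt \<gamma> p"] min' tq p cd by blast
qed

lemma dominant_slope_in_newton_slopes:
  assumes uniq: "slopes_unique N x \<beta>" and dom: "dominant_pair N x \<beta> J K"
  shows "gamma_sum x \<beta> J K \<in> newton_slopes N x \<beta>"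
proof -
  define \<gamma> where "\<gamma> = gamma_sum x \<beta> J K"
  have JK: "(J, K) \<in> index_pairs N" using dom by (simp add: dominant_pair_def index_pairs_def)
  have min: "\<forall>p\<in>index_pairs N. 0 \<le> weight \<gamma> p"
    using dom dominant_pair_iff[OF JK] by (auto simp: \<gamma>_def)
  have w: "weight \<gamma> (J, K) = 0" using weight_gamma_sum(2)[OF JK] by (simp add: \<gamma>_def)
  have \<gamma>: "\<gamma> > 0"
    using JK x_less[OF JK] \<beta>_pos[of J] \<beta>_pos[of K]
    by (auto simp: \<gamma>_def gamma_sum_def index_pairs_def intro!: divide_pos_pos add_pos_pos)
  have "{r \<in> newton_points N x \<beta>. tilt \<gamma> r = 0} = {(0, 0), pair_point x \<beta> J K}"
  proof (intro equalityI subsetI)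
    fix r assume "r \<in> {r \<in> newton_points N x \<beta>. tilt \<gamma> r = 0}"
    hence "r = (0, 0) \<or> (\<exists>a b. (a, b) \<in> index_pairs N \<and> r = pair_point x \<beta> a b \<and> weight \<gamma> (a, b) = 0)"
      by (auto simp: newton_points_eq weight_def)
    thus "r \<in> {(0, 0), pair_point x \<beta> J K}"
      using minimizing_pair_unique[OF uniq \<gamma> min JK w] by auto
  qed (use JK w in \<open>auto simp: newton_points_eq weight_def tilt_def\<close>)
  moreover have "fst (0, 0) < fst (pair_point x \<beta> J K)" using x_less[OF JK] by (simp add: pair_point_def)
  moreover have "\<And>p. p \<in> newton_points N x \<beta> \<Longrightarrow> 0 \<le> tilt \<gamma> p"
    using tilt_minimal_iff[of 0 \<gamma>] min by blast
  ultimately have "newton_edge N x \<beta> (0, 0) (pair_point x \<beta> J K)"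
    and "slope (0, 0) (pair_point x \<beta> J K) = \<gamma>"
    using newton_edge_if_only_minimizers[of N x \<beta> 0 \<gamma> "(0, 0)" "pair_point x \<beta> J K"] by auto
  thus ?thesis unfolding newton_slopes_def mem_Collect_eq \<gamma>_def by metis
qed

end

section \<open>Resonances near the predicted positions\<close>

text \<open>
  Points \<open>c - \<i> \<gamma> h log (1/h) + h w\<close>. Both predicted formulas have this form with
  \<open>w = \<i> * L / (2 * \<Delta>)\<close>, where \<open>\<Delta>\<close> is the distance of the pair and \<open>L\<close> the logarithm.
\<close>
definition ansatz :: "real \<Rightarrow> real \<Rightarrow> real \<Rightarrow> complex \<Rightarrow> complex"
  where "ansatz \<gamma> h c w = of_real c - \<i> * of_real (\<gamma> * h * ln (1 / h)) + of_real h * w"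

text \<open>
  Bounds the distance of \<open>ansatz \<gamma> h c w\<close> from \<open>c\<close> for \<open>cmod w \<le> W\<close>.
\<close>
definition spread :: "real \<Rightarrow> real \<Rightarrow> real \<Rightarrow> real"
  where "spread \<gamma> W h = h * W + \<gamma> * h * ln (1 / h)"

lemma tendsto_spread: "(spread \<gamma> W \<longlongrightarrow> 0) (at_right 0)"
proof -
  have "((\<lambda>h::real. h * ln (1 / h)) \<longlongrightarrow> 0) (at_right 0)" by real_asymp
  hence "((\<lambda>h. h * W + \<gamma> * (h * ln (1 / h))) \<longlongrightarrow> 0 * W + \<gamma> * 0) (at_right 0)"
    by (intro tendsto_intros)
  thus ?thesis by (simp add: spread_def[abs_def] mult.assoc)
qed

lemma norm_ansatz_minus_center:
  assumes "0 < h" "h < 1" "\<gamma> > 0" "cmod w \<le> W"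
  shows "cmod (ansatz \<gamma> h c w - of_real c) \<le> spread \<gamma> W h"
proof -
  have "cmod (of_real h * w - \<i> * of_real (\<gamma> * h * ln (1 / h))) \<le> h * W + \<gamma> * h * ln (1 / h)"
    using assms by (intro order_trans[OF norm_triangle_ineq4] add_mono) (auto simp: norm_mult)
  thus ?thesis by (simp add: ansatz_def spread_def)
qed

lemma center_pos: "M > 0 \<Longrightarrow> c \<in> {2 / M..M / 2} \<Longrightarrow> c > (0::real)"
  by (rule less_le_trans[of 0 "2 / M"]) auto

lemma ansatz_near_string:
  assumes h: "0 < h" "h < 1" and \<gamma>: "\<gamma> > 0" and M: "M > 0" and w: "cmod w \<le> W"
    and c: "c \<in> {2 / M..M / 2}" and s: "spread \<gamma> W h \<le> 1 / M" "spread \<gamma> W h \<le> M / 2"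
  shows "ansatz \<gamma> h c w \<in> near_string \<gamma> M W h"
proof -
  note d = norm_ansatz_minus_center[OF h \<gamma> w, of c]
  have c0: "cmod (of_real c) = c" using center_pos[OF M c] by simp
  have "c - cmod (ansatz \<gamma> h c w) \<le> cmod (ansatz \<gamma> h c w - of_real c)"
    using norm_triangle_ineq2[of "of_real c" "ansatz \<gamma> h c w"] c0 by (simp add: norm_minus_commute)
  moreover have "cmod (ansatz \<gamma> h c w) - c \<le> cmod (ansatz \<gamma> h c w - of_real c)"
    using norm_triangle_ineq2[of "ansatz \<gamma> h c w" "of_real c"] c0 by simp
  moreover have "2 / M = 1 / M + 1 / M" by simp
  ultimately have "1 / M \<le> cmod (ansatz \<gamma> h c w)" "cmod (ansatz \<gamma> h c w) \<le> M"
    using d c s by auto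
  moreover have "\<bar>Im (ansatz \<gamma> h c w) + \<gamma> * h * ln (1 / h)\<bar> \<le> W * h"
    using abs_Im_le_cmod[of w] w h by (simp add: ansatz_def abs_mult)
  ultimately show ?thesis by (simp add: near_string_def)
qed

text \<open>
  The quantization of \<open>c\<close> makes the oscillating factor trivial.
\<close>
lemma phase_ansatz:
  assumes h: "h > 0" and \<Delta>: "\<Delta> > 0" and c: "c = pi * h * of_int m / \<Delta>"
  shows "phase h (ansatz \<gamma> h c (\<i> * L / of_real (2 * \<Delta>) + \<zeta>)) \<Delta>
    = of_real (h powr (- 2 * \<gamma> * \<Delta>)) * exp (- L) * exp (2 * \<i> * of_real \<Delta> * \<zeta>)"
proof -
  have "2 * \<i> * ansatz \<gamma> h c (\<i> * L / of_real (2 * \<Delta>) + \<zeta>) * of_real \<Delta> / of_real h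
      = of_int m * (of_real (2 * pi) * \<i>) + of_real (- 2 * \<gamma> * \<Delta> * ln h) + (- L)
        + 2 * \<i> * of_real \<Delta> * \<zeta>"
    using h \<Delta> by (simp add: ansatz_def c ln_div field_simps)
  moreover have "exp (of_int m * (of_real (2 * pi) * \<i>)) = 1"
    using exp_integer_2pi[of "of_int m"] by (simp add: mult_ac)
  moreover have "exp (of_real (- 2 * \<gamma> * \<Delta> * ln h) :: complex) = of_real (h powr (- 2 * \<gamma> * \<Delta>))"
    using h by (simp only: exp_of_real powr_def) simp
  ultimately show ?thesis unfolding phase_def by (simp only: exp_add mult_1_left)
qed

lemma z_dominant_eq_ansatz:
  assumes "x j < x k"
  shows "z_dominant x C \<beta> j k h m = (let c = pi * h * of_int m / (x k - x j) in
    ansatz (gamma_sum x \<beta> j k) h c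
      (\<i> * Ln (of_real (- C j * C k / (4 * c\<^sup>2))) / of_real (2 * (x k - x j))))"
proof -
  have "- C j * C k * (x k - x j)\<^sup>2 / (4 * pi\<^sup>2 * h\<^sup>2 * (of_int m)\<^sup>2)
      = - C j * C k / (4 * (pi * h * of_int m / (x k - x j))\<^sup>2)"
    using assms by (simp add: power_divide power_mult_distrib)
  thus ?thesis by (simp add: z_dominant_def ansatz_def Let_def)
qed

lemma z_secondary_eq_ansatz:
  "z_secondary x C \<beta> j k h m = ansatz (gamma_diff x \<beta> j k) h (pi * h * of_int m / (x k - x j))
    (\<i> * Ln (of_real (if \<beta> k < \<beta> j then - C j / C k else - C k / C j)) / of_real (2 * (x k - x j)))"
  by (simp add: z_secondary_def ansatz_def)

lemma norm_Ln_of_real_le: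
  assumes "y \<noteq> 0"
  shows "cmod (Ln (of_real y)) \<le> \<bar>ln \<bar>y\<bar>\<bar> + pi"
proof -
  have "\<bar>Re (Ln (of_real y))\<bar> = \<bar>ln \<bar>y\<bar>\<bar>" using assms by simp
  moreover have "\<bar>Im (Ln (of_real y))\<bar> \<le> pi"
    using Im_Ln_le_pi[of "of_real y"] mpi_less_Im_Ln[of "of_real y"] assms by simp
  ultimately show ?thesis using cmod_le[of "Ln (of_real y)"] by linarith
qed

lemma little_o_radius:
  assumes \<delta>: "(\<delta> \<longlongrightarrow> 0) (at_right 0)"
    and P: "eventually (\<lambda>h. P h (h * (\<delta> h / \<Delta>))) (at_right (0::real))"
  shows "\<exists>h0>0. \<exists>r\<in>o[at_right 0](\<lambda>h. h). \<forall>h\<in>{0<..<h0}. P h (r h)"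
proof -
  obtain h0 where "h0 > 0" "\<forall>h>0. h < h0 \<longrightarrow> P h (h * (\<delta> h / \<Delta>))"
    using P unfolding eventually_at_right_field by auto
  moreover have "(\<lambda>h. h * (\<delta> h / \<Delta>)) \<in> o[at_right 0](\<lambda>h. h)"
  proof (rule smalloI_tendsto)
    have "((\<lambda>h. \<delta> h / \<Delta>) \<longlongrightarrow> 0) (at_right 0)"
      using tendsto_divide_zero[OF \<delta>] .
    thus "((\<lambda>h. h * (\<delta> h / \<Delta>) / h) \<longlongrightarrow> 0) (at_right 0)"
      by (rule Lim_transform_eventually) (auto simp: eventually_at_right_field intro!: exI[of _ 1])
  qed (auto simp: eventually_at_right_field intro!: exI[of _ 1])
  ultimately show ?thesis by fastforce
qed

lemma eventually_admissible:
  fixes \<delta> :: "real \<Rightarrow> real" and \<Delta> :: real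
  assumes M: "M > 0" and \<Delta>: "\<Delta> > 0" and \<delta>: "(\<delta> \<longlongrightarrow> 0) (at_right 0)"
  shows "\<forall>\<^sub>F h in at_right 0. 0 < h \<and> h < 1 \<and> spread \<gamma> W h \<le> 1 / M \<and> spread \<gamma> W h \<le> M / 2
    \<and> \<delta> h < 1 / 2 \<and> \<delta> h \<le> \<Delta>"
proof -
  have less: "\<forall>\<^sub>F h in at_right 0. f h < a" if "(f \<longlongrightarrow> 0) (at_right (0::real))" "a > 0" for f and a :: real
    using order_tendstoD(2)[OF that] .
  have "\<forall>\<^sub>F h::real in at_right 0. 0 < h \<and> h < 1"
    by (auto simp: eventually_at_right_field intro!: exI[of _ 1])
  moreover have "\<forall>\<^sub>F h in at_right 0. spread \<gamma> W h < 1 / M" "\<forall>\<^sub>F h in at_right 0. spread \<gamma> W h < M / 2"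
    using M by (intro less tendsto_spread; simp)+
  moreover have "\<forall>\<^sub>F h in at_right 0. \<delta> h < 1 / 2" "\<forall>\<^sub>F h in at_right 0. \<delta> h < \<Delta>"
    using \<Delta> by (intro less \<delta>; simp)+
  ultimately show ?thesis by eventually_elim auto
qed

lemma norm_perturbed_square_le:
  fixes a b :: complex
  assumes "cmod a \<le> A" "cmod b \<le> B"
  shows "cmod ((1 + a)\<^sup>2 * (1 + b) - 1) \<le> (1 + A)\<^sup>2 * (1 + B) - 1"
proof -
  have A0: "0 \<le> A" and B0: "0 \<le> B" using assms norm_ge_zero order_trans by blast+
  have "cmod ((1 + a)\<^sup>2 * (1 + b) - 1) = cmod (a * (2 + a) + (1 + a)\<^sup>2 * b)"
    by (simp add: power2_eq_square algebra_simps)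
  also have "\<dots> \<le> A * (2 + A) + (1 + A)\<^sup>2 * B"
  proof (intro norm_triangle_le add_mono)
    have "cmod (2 + a) \<le> 2 + A" using assms by (intro norm_triangle_le) simp
    thus "cmod (a * (2 + a)) \<le> A * (2 + A)" unfolding norm_mult using assms A0 by (intro mult_mono) auto
    have "cmod (1 + a) \<le> 1 + A" using assms by (intro norm_triangle_le) simp
    thus "cmod ((1 + a)\<^sup>2 * b) \<le> (1 + A)\<^sup>2 * B"
      unfolding norm_mult norm_power using assms A0 B0 by (intro mult_mono power_mono) auto
  qed
  also have "\<dots> = (1 + A)\<^sup>2 * (1 + B) - 1" by (simp add: power2_eq_square algebra_simps)
  finally show ?thesis .
qed

lemma tendsto_powr_at_right_0: "\<eta> > 0 \<Longrightarrow> ((\<lambda>h. h powr \<eta>) \<longlongrightarrow> 0) (at_right (0::real))"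
  by real_asymp

lemma ansatz_add: "ansatz \<gamma> h c w + of_real h * \<zeta> = ansatz \<gamma> h c (w + \<zeta>)"
  by (simp add: ansatz_def algebra_simps)

context point_interactions
begin

text \<open>
  The line passes through the origin and the point of one pair, so the equation is
  \<open>1 = pair_term h z (j, k)\<close> up to lower order. The ansatz solves it with \<open>1 / c\<^sup>2\<close> in place of the
  \<open>1 / z\<^sup>2\<close> in the product of the couplings; the relative error of this replacement is
  \<open>O(h log (1/h))\<close>.
\<close>
lemma dominant_resonances:
  assumes jk: "(j, k) \<in> index_pairs N" and \<gamma>: "\<gamma> > 0" "\<gamma> = gamma_sum x \<beta> j k" and M: "M > 0"
    and min: "\<forall>p\<in>index_pairs N. 0 \<le> weight \<gamma> p"
    and only: "{p \<in> index_pairs N. weight \<gamma> p = 0} = {(j, k)}"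
  shows "\<exists>h0>0. \<exists>r\<in>o[at_right 0](\<lambda>h. h). \<forall>h\<in>{0<..<h0}. \<forall>m::int.
    pi * h * of_int m / (x k - x j) \<in> {2 / M..M / 2} \<longrightarrow>
      (\<exists>z. is_resonance N x C \<beta> h z \<and> cmod (z - z_dominant x C \<beta> j k h m) \<le> r h)"
proof -
  define \<Delta> where "\<Delta> = x k - x j"
  have \<Delta>: "\<Delta> > 0" using x_less[OF jk] by (simp add: \<Delta>_def)
  define P where "P = - C j * C k"
  have P: "P \<noteq> 0" using C_nonzero[of j] C_nonzero[of k] jk by (auto simp: P_def index_pairs_def)
  define L where "L = (\<lambda>c::real. Ln (of_real (P / (4 * c\<^sup>2))))"
  \<comment> \<open>\<open>L c\<close> is bounded because \<open>c\<close> stays in a compact subset of the positive reals.\<close>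
  define \<Lambda> where "\<Lambda> = \<bar>ln (\<bar>P\<bar> / (4 * (2 / M)\<^sup>2))\<bar> + \<bar>ln (\<bar>P\<bar> / (4 * (M / 2)\<^sup>2))\<bar> + pi"
  define W where "W = \<Lambda> / (2 * \<Delta>) + 1"
  have W: "W \<ge> 0" using \<Delta> by (simp add: W_def \<Lambda>_def add_nonneg_nonneg)
  have L: "cmod (L c) \<le> \<Lambda>" if c: "c \<in> {2 / M..M / 2}" for c
  proof -
    have c0: "c > 0" using center_pos[OF M c] .
    have le: "\<bar>P\<bar> / (4 * (M / 2)\<^sup>2) \<le> \<bar>P\<bar> / (4 * c\<^sup>2)" "\<bar>P\<bar> / (4 * c\<^sup>2) \<le> \<bar>P\<bar> / (4 * (2 / M)\<^sup>2)"
      using c c0 M P by (auto intro!: divide_left_mono mult_left_mono power_mono)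
    have "ln (\<bar>P\<bar> / (4 * (M / 2)\<^sup>2)) \<le> ln (\<bar>P\<bar> / (4 * c\<^sup>2))" "ln (\<bar>P\<bar> / (4 * c\<^sup>2)) \<le> ln (\<bar>P\<bar> / (4 * (2 / M)\<^sup>2))"
      using le P c0 M by (subst ln_le_cancel_iff; simp)+
    hence "\<bar>ln (\<bar>P\<bar> / (4 * c\<^sup>2))\<bar> + pi \<le> \<Lambda>" unfolding \<Lambda>_def by linarith
    thus ?thesis using norm_Ln_of_real_le[of "P / (4 * c\<^sup>2)"] P c0 by (simp add: L_def)
  qed
  obtain K \<eta> where K: "K \<ge> 0" "\<eta> > 0"
    "\<And>h z. 0 < h \<Longrightarrow> h < 1 \<Longrightarrow> z \<in> near_string \<gamma> M W h \<Longrightarrow>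
       cmod (secular_function h z - ((if (0::real) = 0 then 1 else 0)
         - (\<Sum>p | p \<in> index_pairs N \<and> weight \<gamma> p = 0. pair_term h z p))) \<le> K * h powr (0 + \<eta>)"
    using secular_leading_part[OF \<gamma>(1) M W order_refl min] by blast
  have lead: "cmod (secular_function h z - (1 - pair_term h z (j, k))) \<le> K * h powr \<eta>"
    if "0 < h" "h < 1" "z \<in> near_string \<gamma> M W h" for h z
    using K(3) that unfolding only by simp
  define \<delta> where "\<delta> = (\<lambda>h. (1 + M / 2 * spread \<gamma> W h)\<^sup>2 * (1 + K * h powr \<eta>) - 1)"
  have "(\<delta> \<longlongrightarrow> (1 + M / 2 * 0)\<^sup>2 * (1 + K * 0) - 1) (at_right 0)"
    unfolding \<delta>_def by (intro tendsto_intros tendsto_spread tendsto_powr_at_right_0 K(2))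
  hence \<delta>: "(\<delta> \<longlongrightarrow> 0) (at_right 0)" by simp
  show ?thesis
    unfolding \<Delta>_def[symmetric]
  proof (rule little_o_radius[OF \<delta>, of _ \<Delta>], rule eventually_mono[OF eventually_admissible[OF M \<Delta> \<delta>, of \<gamma> W]],
      elim conjE, intro allI impI)
    fix h and m :: int
    assume h: "0 < h" "h < 1" and s: "spread \<gamma> W h \<le> 1 / M" "spread \<gamma> W h \<le> M / 2"
      and \<delta>h: "\<delta> h < 1 / 2" "\<delta> h \<le> \<Delta>" and "pi * h * of_int m / \<Delta> \<in> {2 / M..M / 2}"
    define c where "c = pi * h * of_int m / \<Delta>"
    have c: "c \<in> {2 / M..M / 2}" unfolding c_def by fact
    have c0: "c > 0" using center_pos[OF M c] .
    define w where "w = \<i> * L c / of_real (2 * \<Delta>)"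
    have w: "cmod (w + \<zeta>) \<le> W" if "\<zeta> \<in> cball 0 1" for \<zeta>
    proof -
      have "cmod w \<le> \<Lambda> / (2 * \<Delta>)"
        using L[OF c] \<Delta> by (simp add: w_def norm_divide norm_mult divide_right_mono)
      thus ?thesis unfolding W_def using that by (intro norm_triangle_le add_mono) auto
    qed
    have near: "ansatz \<gamma> h c (w + \<zeta>) \<in> near_string \<gamma> M W h" if "\<zeta> \<in> cball 0 1" for \<zeta>
      by (rule ansatz_near_string[OF h \<gamma>(1) M w[OF that] c s])
    have nz: "ansatz \<gamma> h c (w + \<zeta>) \<noteq> 0" if "\<zeta> \<in> cball 0 1" for \<zeta>
      using near[OF that] M by (auto simp: near_string_def)
    have pt: "pair_term h (ansatz \<gamma> h c (w + \<zeta>)) (j, k)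
        = (of_real c / ansatz \<gamma> h c (w + \<zeta>))\<^sup>2 * exp (2 * \<i> * of_real \<Delta> * \<zeta>)"
      if "\<zeta> \<in> cball 0 1" for \<zeta>
    proof -
      define z where "z = ansatz \<gamma> h c (w + \<zeta>)"
      have z: "z \<noteq> 0" using nz[OF that] by (simp add: z_def)
      have "\<beta> j + \<beta> k = 2 * \<gamma> * \<Delta>" 
        using weight_gamma_sum(2)[OF jk, of \<gamma>] \<gamma>(2) by (simp add: weight_eq \<Delta>_def)
      hence "h powr \<beta> j * h powr \<beta> k * h powr (- 2 * \<gamma> * \<Delta>) = 1"
        using h by (simp flip: powr_add)
      hence hp: "complex_of_real (h powr \<beta> j) * of_real (h powr \<beta> k) * of_real (h powr (- 2 * \<gamma> * \<Delta>)) = 1"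
        by (metis of_real_1 of_real_mult)
      have eL: "exp (- L c) = of_real (4 * c\<^sup>2 / P)"
        unfolding exp_minus L_def using P c0 by (subst exp_Ln) (auto simp flip: of_real_inverse)
      have "pair_term h z (j, k) = coupling C \<beta> h z j * coupling C \<beta> h z k *
          (of_real (h powr (- 2 * \<gamma> * \<Delta>)) * exp (- L c) * exp (2 * \<i> * of_real \<Delta> * \<zeta>))"
        using phase_ansatz[OF h(1) \<Delta> c_def, of \<gamma> "L c" \<zeta>] \<Delta> by (simp add: pair_term_def z_def w_def \<Delta>_def)
      also have "\<dots> = (complex_of_real (h powr \<beta> j) * of_real (h powr \<beta> k) * of_real (h powr (- 2 * \<gamma> * \<Delta>)))
          * (of_real P / (4 * z\<^sup>2) * of_real (4 * c\<^sup>2 / P)) * exp (2 * \<i> * of_real \<Delta> * \<zeta>)"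
        using z unfolding eL by (simp add: coupling_def P_def power2_eq_square field_simps)
      also have "of_real P / (4 * z\<^sup>2) * of_real (4 * c\<^sup>2 / P) = (of_real c / z)\<^sup>2"
        using P z by (simp add: power_divide)
      finally show ?thesis unfolding hp by (simp add: z_def)
    qed
    obtain z where "is_resonance N x C \<beta> h z" "cmod (z - ansatz \<gamma> h c w) \<le> h * (\<delta> h / \<Delta>)"
    proof (rule resonance_near[OF h(1) \<Delta> \<delta>h, of "ansatz \<gamma> h c w"
          "\<lambda>\<zeta>. (of_real c / ansatz \<gamma> h c (w + \<zeta>))\<^sup>2"])
      show "continuous_on (cball 0 1) (\<lambda>\<zeta>. (of_real c / ansatz \<gamma> h c (w + \<zeta>))\<^sup>2)"
        using nz unfolding ansatz_def by (intro continuous_intros) auto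
      fix \<zeta> :: complex assume \<zeta>: "\<zeta> \<in> cball 0 1"
      show "ansatz \<gamma> h c w + of_real h * \<zeta> \<noteq> 0" "(of_real c / ansatz \<gamma> h c (w + \<zeta>))\<^sup>2 \<noteq> 0"
        using nz[OF \<zeta>] c0 by (simp_all add: ansatz_add)
      define z where "z = ansatz \<gamma> h c (w + \<zeta>)"
      define \<rho> where "\<rho> = secular_function h z - (1 - pair_term h z (j, k))"
      have \<rho>: "cmod \<rho> \<le> K * h powr \<eta>"
        unfolding \<rho>_def z_def by (rule lead[OF h near[OF \<zeta>]])
      have z0: "z \<noteq> 0" using nz[OF \<zeta>] by (simp add: z_def)
      have "cmod (z / of_real c - 1) = cmod (z - of_real c) / c"
      proof -
        have "z / of_real c - 1 = (z - of_real c) / of_real c" using c0 by (simp add: diff_divide_distrib)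
        thus ?thesis using c0 by (simp add: norm_divide)
      qed
      also have "\<dots> \<le> spread \<gamma> W h / (2 / M)"
        using norm_ansatz_minus_center[OF h \<gamma>(1) w[OF \<zeta>], of c] c c0 M
        by (intro frac_le) (auto simp: z_def intro: order_trans[OF norm_ge_zero])
      finally have quot: "cmod (z / of_real c - 1) \<le> M / 2 * spread \<gamma> W h" by (simp add: mult.commute)
      have "secular_function h z = 1 + \<rho> - (of_real c / z)\<^sup>2 * exp (2 * \<i> * of_real \<Delta> * \<zeta>)"
        using pt[OF \<zeta>] by (simp add: \<rho>_def z_def)
      hence "secular_function h z / (of_real c / z)\<^sup>2 + exp (2 * \<i> * of_real \<Delta> * \<zeta>) - 1
          = (1 + (z / of_real c - 1))\<^sup>2 * (1 + \<rho>) - 1"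
        using z0 c0 by (simp add: field_simps)
      also have "cmod \<dots> \<le> \<delta> h"
        unfolding \<delta>_def by (rule norm_perturbed_square_le[OF quot \<rho>])
      finally show "cmod (secular_function h (ansatz \<gamma> h c w + of_real h * \<zeta>) / (of_real c / ansatz \<gamma> h c (w + \<zeta>))\<^sup>2
          + exp (2 * \<i> * of_real \<Delta> * \<zeta>) - 1) \<le> \<delta> h"
        by (simp add: ansatz_add z_def)
    qed
    moreover have "z_dominant x C \<beta> j k h m = ansatz \<gamma> h c w"
      using z_dominant_eq_ansatz[OF x_less[OF jk]] by (simp add: Let_def c_def w_def L_def P_def \<Delta>_def \<gamma>(2))
    ultimately show "\<exists>z. is_resonance N x C \<beta> h z \<and> cmod (z - z_dominant x C \<beta> j k h m) \<le> h * (\<delta> h / \<Delta>)"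
      by auto
  qed
qed

text \<open>
  The line passes through the points of two pairs with a common index \<open>s\<close>, so the equation is
  \<open>pair_term h z p1 + pair_term h z p2 = 0\<close> up to lower order. In the quotient of the terms the
  coupling at \<open>s\<close> and the factors \<open>1 / z\<close> cancel, and the ansatz is an exact solution. The longer
  pair \<open>p2\<close> contains \<open>k\<close> if \<open>s\<close> is on the left and \<open>j\<close> if \<open>s\<close> is on the right. Since \<open>\<gamma> > 0\<close>, its
  unshared index \<open>q2\<close> is the one with the larger exponent, which decides the branch in
  \<open>z_secondary\<close>.
\<close>
lemma secondary_resonances:
  assumes p1: "p1 \<in> index_pairs N" and p2: "p2 \<in> index_pairs N" and jk: "(j, k) \<in> index_pairs N"
    and orient: "p1 = (s, j) \<and> p2 = (s, k) \<or> p1 = (k, s) \<and> p2 = (j, s)"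
    and \<gamma>: "\<gamma> > 0" and M: "M > 0" and \<mu>: "\<mu> < 0"
    and min: "\<forall>p\<in>index_pairs N. \<mu> \<le> weight \<gamma> p"
    and only: "{p \<in> index_pairs N. weight \<gamma> p = \<mu>} = {p1, p2}"
  shows "\<gamma> = gamma_diff x \<beta> j k"
    and "\<exists>h0>0. \<exists>r\<in>o[at_right 0](\<lambda>h. h). \<forall>h\<in>{0<..<h0}. \<forall>m::int.
      pi * h * of_int m / (x k - x j) \<in> {2 / M..M / 2} \<longrightarrow>
        (\<exists>z. is_resonance N x C \<beta> h z \<and> cmod (z - z_secondary x C \<beta> j k h m) \<le> r h)"
proof -
  define \<Delta> where "\<Delta> = x k - x j"
  have \<Delta>: "\<Delta> > 0" using x_less[OF jk] by (simp add: \<Delta>_def)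
  define q1 q2 where "q1 = (if p1 = (s, j) then j else k)" and "q2 = (if p1 = (s, j) then k else j)"
  have jks: "j \<noteq> k" "j \<noteq> s" "k \<noteq> s" using p1 p2 jk orient by (auto simp: index_pairs_def)
  have weights: "weight \<gamma> p1 = \<mu>" "weight \<gamma> p2 = \<mu>" using only by auto
  have p12: "p1 \<noteq> p2" using orient jks by auto
  have q: "(q1 = j \<and> q2 = k) \<or> (q1 = k \<and> q2 = j)" by (simp add: q1_def q2_def)
  have \<beta>q: "\<beta> q2 - \<beta> q1 = 2 * \<gamma> * \<Delta>"
    using orient weights jks by (auto simp: q1_def q2_def weight_eq \<Delta>_def algebra_simps)
  have "0 < 2 * \<gamma> * \<Delta>" using \<gamma> \<Delta> by simp
  hence \<beta>less: "\<beta> q1 < \<beta> q2" using \<beta>q by linarith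
  have "\<bar>\<beta> k - \<beta> j\<bar> = 2 * \<gamma> * \<Delta>" using q \<beta>q \<beta>less by auto
  hence "\<gamma> = \<bar>\<beta> k - \<beta> j\<bar> / (2 * \<Delta>)" using \<Delta> by simp
  thus gd: "\<gamma> = gamma_diff x \<beta> j k" by (simp only: gamma_diff_def \<Delta>_def)
  have Cq: "C q1 \<noteq> 0" "C q2 \<noteq> 0" using C_nonzero[of j] C_nonzero[of k] jk q by (auto simp: index_pairs_def)
  define y where "y = - C q2 / C q1"
  have y: "y \<noteq> 0" using Cq by (simp add: y_def)
  have y_eq: "(if \<beta> k < \<beta> j then - C j / C k else - C k / C j) = y" using q \<beta>less by (auto simp: y_def)
  define L where "L = Ln (of_real y)"
  define W where "W = cmod L / (2 * \<Delta>) + 1"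
  have W: "W \<ge> 0" using \<Delta> by (simp add: W_def add_nonneg_nonneg)
  obtain K \<eta> where K: "K \<ge> 0" "\<eta> > 0"
    "\<And>h z. 0 < h \<Longrightarrow> h < 1 \<Longrightarrow> z \<in> near_string \<gamma> M W h \<Longrightarrow>
       cmod (secular_function h z - ((if \<mu> = 0 then 1 else 0)
         - (\<Sum>p | p \<in> index_pairs N \<and> weight \<gamma> p = \<mu>. pair_term h z p))) \<le> K * h powr (\<mu> + \<eta>)"
    using secular_leading_part[OF \<gamma> M W less_imp_le[OF \<mu>] min] by blast
  have lead: "cmod (secular_function h z + (pair_term h z p1 + pair_term h z p2)) \<le> K * h powr (\<mu> + \<eta>)"
    if "0 < h" "h < 1" "z \<in> near_string \<gamma> M W h" for h z
    using K(3) that \<mu> p12 unfolding only by (simp add: algebra_simps)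
  obtain a b where ab: "p1 = (a, b)" by (cases p1)
  define \<kappa> where "\<kappa> = \<bar>C a\<bar> / (2 * M) * (\<bar>C b\<bar> / (2 * M)) * exp (- 2 * (x b - x a) * W)"
  have \<kappa>: "\<kappa> > 0" using M C_nonzero[of a] C_nonzero[of b] p1 by (auto simp: \<kappa>_def ab index_pairs_def)
  have lower: "\<kappa> * h powr \<mu> \<le> cmod (pair_term h z p1)"
    if "0 < h" "z \<in> near_string \<gamma> M W h" for h z
    using norm_pair_term_bounds(2)[OF that(1) M that(2), of a b "x b - x a"] p1 weights
    by (simp add: ab \<kappa>_def)
  define \<delta> where "\<delta> = (\<lambda>h. K / \<kappa> * h powr \<eta>)"
  have "(\<delta> \<longlongrightarrow> K / \<kappa> * 0) (at_right 0)"
    unfolding \<delta>_def by (intro tendsto_intros tendsto_powr_at_right_0 K(2))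
  hence \<delta>: "(\<delta> \<longlongrightarrow> 0) (at_right 0)" by simp
  show "\<exists>h0>0. \<exists>r\<in>o[at_right 0](\<lambda>h. h). \<forall>h\<in>{0<..<h0}. \<forall>m::int.
      pi * h * of_int m / (x k - x j) \<in> {2 / M..M / 2} \<longrightarrow>
        (\<exists>z. is_resonance N x C \<beta> h z \<and> cmod (z - z_secondary x C \<beta> j k h m) \<le> r h)"
    unfolding \<Delta>_def[symmetric]
  proof (rule little_o_radius[OF \<delta>, of _ \<Delta>], rule eventually_mono[OF eventually_admissible[OF M \<Delta> \<delta>, of \<gamma> W]],
      elim conjE, intro allI impI)
    fix h and m :: int
    assume h: "0 < h" "h < 1" and s: "spread \<gamma> W h \<le> 1 / M" "spread \<gamma> W h \<le> M / 2"
      and \<delta>h: "\<delta> h < 1 / 2" "\<delta> h \<le> \<Delta>" and "pi * h * of_int m / \<Delta> \<in> {2 / M..M / 2}"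
    define c where "c = pi * h * of_int m / \<Delta>"
    have c: "c \<in> {2 / M..M / 2}" unfolding c_def by fact
    define w where "w = \<i> * L / of_real (2 * \<Delta>)"
    have w: "cmod (w + \<zeta>) \<le> W" if "\<zeta> \<in> cball 0 1" for \<zeta>
    proof -
      have "cmod w \<le> cmod L / (2 * \<Delta>)"
        using \<Delta> by (simp add: w_def norm_divide norm_mult)
      thus ?thesis unfolding W_def using that by (intro norm_triangle_le add_mono) auto
    qed
    have near: "ansatz \<gamma> h c (w + \<zeta>) \<in> near_string \<gamma> M W h" if "\<zeta> \<in> cball 0 1" for \<zeta>
      by (rule ansatz_near_string[OF h \<gamma> M w[OF that] c s])
    have nz: "ansatz \<gamma> h c (w + \<zeta>) \<noteq> 0" if "\<zeta> \<in> cball 0 1" for \<zeta>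
      using near[OF that] M by (auto simp: near_string_def)
    have pt_nz: "pair_term h (ansatz \<gamma> h c (w + \<zeta>)) p1 \<noteq> 0" if "\<zeta> \<in> cball 0 1" for \<zeta>
      using lower[OF h(1) near[OF that]] \<kappa> h
      by (metis mult_pos_pos norm_zero not_le powr_gt_zero order_less_irrefl less_le_trans)
    have pt: "pair_term h (ansatz \<gamma> h c (w + \<zeta>)) p2
        = - exp (2 * \<i> * of_real \<Delta> * \<zeta>) * pair_term h (ansatz \<gamma> h c (w + \<zeta>)) p1"
      if "\<zeta> \<in> cball 0 1" for \<zeta>
    proof -
      define z where "z = ansatz \<gamma> h c (w + \<zeta>)"
      have z: "z \<noteq> 0" using nz[OF that] by (simp add: z_def)
      have "\<beta> q2 + - 2 * \<gamma> * \<Delta> = \<beta> q1" using \<beta>q by simp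
      hence "h powr \<beta> q2 * h powr (- 2 * \<gamma> * \<Delta>) = h powr \<beta> q1"
        by (simp only: powr_add[symmetric])
      hence hp: "complex_of_real (h powr \<beta> q2) * of_real (h powr (- 2 * \<gamma> * \<Delta>)) = of_real (h powr \<beta> q1)"
        by (metis of_real_mult)
      have eL: "exp (- L) = - of_real (C q1) / of_real (C q2)"
        unfolding exp_minus L_def using y by (subst exp_Ln) (auto simp: y_def)
      have "coupling C \<beta> h z q2 * phase h z \<Delta> = coupling C \<beta> h z q2 *
          (of_real (h powr (- 2 * \<gamma> * \<Delta>)) * exp (- L) * exp (2 * \<i> * of_real \<Delta> * \<zeta>))"
        using phase_ansatz[OF h(1) \<Delta> c_def, of \<gamma> L \<zeta>] by (simp add: z_def w_def)
      also have "\<dots> = - (of_real (C q1) * (complex_of_real (h powr \<beta> q2) * of_real (h powr (- 2 * \<gamma> * \<Delta>)))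
          / (2 * \<i> * z)) * exp (2 * \<i> * of_real \<Delta> * \<zeta>)"
        using z Cq unfolding eL by (simp add: coupling_def field_simps)
      also have "\<dots> = - exp (2 * \<i> * of_real \<Delta> * \<zeta>) * coupling C \<beta> h z q1"
        unfolding hp by (simp add: coupling_def)
      finally have ratio: "coupling C \<beta> h z q2 * phase h z \<Delta>
          = - exp (2 * \<i> * of_real \<Delta> * \<zeta>) * coupling C \<beta> h z q1" .
      have ph: "phase h z (l + \<Delta>) = phase h z l * phase h z \<Delta>" for l
        by (simp add: phase_def ring_distribs add_divide_distrib exp_add)
      have pt1: "pair_term h z p1 = coupling C \<beta> h z s * coupling C \<beta> h z q1 * phase h z \<bar>x q1 - x s\<bar>"
        using orient jks by (auto simp: pair_term_def q1_def abs_minus_commute mult.commute)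
      have pt2: "pair_term h z p2 = coupling C \<beta> h z s * coupling C \<beta> h z q2 * phase h z \<bar>x q2 - x s\<bar>"
        using orient jks by (auto simp: pair_term_def q2_def abs_minus_commute mult.commute)
      have "\<bar>x q2 - x s\<bar> = \<bar>x q1 - x s\<bar> + \<Delta>"
        using orient jks p1 p2 x_less[OF jk] x_less[of s j] x_less[of s k] x_less[of j s] x_less[of k s]
        by (auto simp: q1_def q2_def \<Delta>_def)
      hence "pair_term h z p2 = coupling C \<beta> h z s * phase h z \<bar>x q1 - x s\<bar> * (coupling C \<beta> h z q2 * phase h z \<Delta>)"
        unfolding pt2 by (simp add: ph mult_ac)
      thus ?thesis unfolding ratio z_def[symmetric] by (simp add: pt1 mult_ac)
    qed
    obtain z where "is_resonance N x C \<beta> h z" "cmod (z - ansatz \<gamma> h c w) \<le> h * (\<delta> h / \<Delta>)"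
    proof (rule resonance_near[OF h(1) \<Delta> \<delta>h, of "ansatz \<gamma> h c w"
          "\<lambda>\<zeta>. - pair_term h (ansatz \<gamma> h c (w + \<zeta>)) p1"])
      have "continuous_on (cball 0 1) (\<lambda>\<zeta>. ansatz \<gamma> h c (w + \<zeta>))"
        unfolding ansatz_def by (intro continuous_intros)
      thus "continuous_on (cball 0 1) (\<lambda>\<zeta>. - pair_term h (ansatz \<gamma> h c (w + \<zeta>)) p1)"
        unfolding pair_term_def ab prod.case
        by (intro continuous_intros continuous_on_coupling continuous_on_phase nz)
      fix \<zeta> :: complex assume \<zeta>: "\<zeta> \<in> cball 0 1"
      show "ansatz \<gamma> h c w + of_real h * \<zeta> \<noteq> 0" "- pair_term h (ansatz \<gamma> h c (w + \<zeta>)) p1 \<noteq> 0"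
        using nz[OF \<zeta>] pt_nz[OF \<zeta>] by (simp_all add: ansatz_add)
      define z where "z = ansatz \<gamma> h c (w + \<zeta>)"
      define \<rho> where "\<rho> = secular_function h z + (pair_term h z p1 + pair_term h z p2)"
      have \<rho>: "cmod \<rho> \<le> K * h powr (\<mu> + \<eta>)"
        unfolding \<rho>_def z_def by (rule lead[OF h near[OF \<zeta>]])
      have p0: "pair_term h z p1 \<noteq> 0" using pt_nz[OF \<zeta>] by (simp add: z_def)
      have "secular_function h z = \<rho> - pair_term h z p1 + exp (2 * \<i> * of_real \<Delta> * \<zeta>) * pair_term h z p1"
        using pt[OF \<zeta>] by (simp add: \<rho>_def z_def)
      hence "secular_function h z / (- pair_term h z p1) + exp (2 * \<i> * of_real \<Delta> * \<zeta>) - 1 = - (\<rho> / pair_term h z p1)"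
        using p0 by (simp add: field_simps)
      also have "cmod \<dots> \<le> K * h powr (\<mu> + \<eta>) / (\<kappa> * h powr \<mu>)"
        unfolding norm_minus_cancel norm_divide
        using \<rho> lower[OF h(1) near[OF \<zeta>]] \<kappa> h K(1) by (intro frac_le) (auto simp: z_def)
      also have "\<dots> = \<delta> h" using h by (simp add: \<delta>_def powr_add)
      finally show "cmod (secular_function h (ansatz \<gamma> h c w + of_real h * \<zeta>) / (- pair_term h (ansatz \<gamma> h c (w + \<zeta>)) p1)
          + exp (2 * \<i> * of_real \<Delta> * \<zeta>) - 1) \<le> \<delta> h"
        by (simp add: ansatz_add z_def)
    qed
    moreover have "z_secondary x C \<beta> j k h m = ansatz \<gamma> h c w"
      unfolding z_secondary_eq_ansatz y_eq by (simp add: c_def w_def L_def \<Delta>_def gd)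
    ultimately show "\<exists>z. is_resonance N x C \<beta> h z \<and> cmod (z - z_secondary x C \<beta> j k h m) \<le> h * (\<delta> h / \<Delta>)"
      by auto
  qed
qed

text \<open>
  The values \<open>h = \<Delta> / (pi * m)\<close> keep the centre at 1, so every term of the prediction except
  \<open>- \<i> \<gamma> h log (1/h)\<close> is \<open>O(h)\<close>.
\<close>
lemma resonance_string_if_resonances:
  assumes \<Delta>: "\<Delta> > 0" and h0: "h0 > 0" and r: "r \<in> o[at_right 0](\<lambda>h. h)"
    and res: "\<And>h m. 0 < h \<Longrightarrow> h < h0 \<Longrightarrow> pi * h * of_int m / \<Delta> = 1 \<Longrightarrow>
      \<exists>z. is_resonance N x C \<beta> h z \<and> cmod (z - ansatz \<gamma> h 1 w) \<le> r h"
  shows "\<exists>hs zs. resonance_string N x C \<beta> \<gamma> hs zs"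
proof -
  have "\<forall>\<^sub>F h in at_right 0. norm (r h) \<le> 1 * norm h" using landau_o.smallD[OF r, of 1] by simp
  then obtain h1 where h1: "h1 > 0" "\<And>h. 0 < h \<Longrightarrow> h < h1 \<Longrightarrow> \<bar>r h\<bar> \<le> h"
    unfolding eventually_at_right_field by auto
  define W where "W = cmod w + 1"
  have W: "W > 0" by (simp add: W_def add_nonneg_pos)
  define b where "b = Min {h0, h1, 1 / (2 * W)}"
  have b: "b > 0" "b \<le> h0" "b \<le> h1" "b \<le> 1 / (2 * W)" using h0 h1 W by (auto simp: b_def)
  obtain n0 :: nat where n0: "\<Delta> / (pi * b) < n0" using reals_Archimedean2 by blast
  define hs where "hs = (\<lambda>n. \<Delta> / (pi * real (n + n0)))"
  have n0_pos: "real n0 > 0" using n0 \<Delta> b by (meson divide_pos_pos less_trans mult_pos_pos pi_gt_zero)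
  have hs: "0 < hs n" "hs n < b" for n
  proof -
    have pos: "real (n + n0) > 0" using n0_pos by simp
    thus "0 < hs n" using \<Delta> by (simp add: hs_def)
    have "\<Delta> < pi * b * real (n + n0)"
      using n0 b by (simp add: field_simps) (smt (verit) mult_nonneg_nonneg of_nat_0_le_iff pi_ge_zero)
    thus "hs n < b" using pos by (simp add: hs_def divide_less_eq mult_ac)
  qed
  have "\<exists>z. is_resonance N x C \<beta> (hs n) z \<and> cmod (z - ansatz \<gamma> (hs n) 1 w) \<le> r (hs n)" for n
    using hs[of n] b \<Delta> n0_pos by (intro res[of _ "int (n + n0)"]) (auto simp: hs_def)
  then obtain zs where zs: "\<And>n. is_resonance N x C \<beta> (hs n) (zs n)"
    "\<And>n. cmod (zs n - ansatz \<gamma> (hs n) 1 w) \<le> r (hs n)"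
    by metis
  have dev: "cmod (zs n - (1 - \<i> * of_real (\<gamma> * hs n * ln (1 / hs n)))) \<le> W * hs n" for n
  proof -
    have "zs n - (1 - \<i> * of_real (\<gamma> * hs n * ln (1 / hs n)))
        = (zs n - ansatz \<gamma> (hs n) 1 w) + of_real (hs n) * w"
      by (simp add: ansatz_def)
    also have "cmod \<dots> \<le> hs n + hs n * cmod w"
    proof (intro norm_triangle_le add_mono)
      show "cmod (zs n - ansatz \<gamma> (hs n) 1 w) \<le> hs n"
        using zs(2)[of n] h1(2)[of "hs n"] hs[of n] b by simp
    qed (use hs[of n] in \<open>simp add: norm_mult\<close>)
    finally show ?thesis by (simp add: W_def algebra_simps)
  qed
  have "resonance_string N x C \<beta> \<gamma> hs zs"
    unfolding resonance_string_def
  proof (intro conjI allI)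
    show "hs n > 0" for n by (rule hs)
    show "hs \<longlonglongrightarrow> 0"
    proof -
      have "(\<lambda>n. \<Delta> / pi * inverse (real (n + n0))) \<longlonglongrightarrow> \<Delta> / pi * 0"
        by (intro tendsto_intros LIMSEQ_ignore_initial_segment[OF lim_inverse_n])
      thus ?thesis by (simp add: hs_def[abs_def] divide_inverse mult_ac)
    qed
    show "is_resonance N x C \<beta> (hs n) (zs n)" for n by (rule zs)
    show "\<exists>U. compact (closure U) \<and> closure U \<subseteq> {0<..} \<and> (\<forall>n. Re (zs n) \<in> U)"
    proof (intro exI[of _ "{1/2..3/2}"] conjI allI)
      fix n
      have "\<bar>Re (zs n) - 1\<bar> \<le> W * hs n"
        using abs_Re_le_cmod[of "zs n - (1 - \<i> * of_real (\<gamma> * hs n * ln (1 / hs n)))"] dev[of n] by simp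
      also have "\<dots> \<le> W * (1 / (2 * W))" using hs(2)[of n] b W by (intro mult_left_mono) auto
      finally have le: "\<bar>Re (zs n) - 1\<bar> \<le> 1 / 2" using W by simp
      show "Re (zs n) \<in> {1/2..3/2}" using abs_le_D1[OF le] abs_le_D2[OF le] by simp
    qed auto
    show "(\<lambda>n. Im (zs n) + \<gamma> * hs n * ln (1 / hs n)) \<in> O(hs)"
    proof (rule bigoI[of _ W], rule always_eventually, rule allI)
      fix n
      show "norm (Im (zs n) + \<gamma> * hs n * ln (1 / hs n)) \<le> W * norm (hs n)"
        using abs_Im_le_cmod[of "zs n - (1 - \<i> * of_real (\<gamma> * hs n * ln (1 / hs n)))"] dev[of n] hs(1)[of n]
        by simp
    qed
  qed
  thus ?thesis by blast
qed

end

section \<open>Strings of resonances\<close>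

context point_interactions
begin

lemma tilt_pair_point: "tilt \<gamma> (pair_point x \<beta> j k) = weight \<gamma> (j, k)"
  by (simp add: weight_def)

lemma pair_edge_weights:
  assumes edge: "newton_edge N x \<beta> (pair_point x \<beta> a b) (pair_point x \<beta> c d)"
    and \<gamma>: "\<gamma> = slope (pair_point x \<beta> a b) (pair_point x \<beta> c d)"
    and min: "\<mu> \<le> 0" "\<forall>p\<in>index_pairs N. \<mu> \<le> weight \<gamma> p"
    and attained: "r \<in> newton_points N x \<beta>" "tilt \<gamma> r = \<mu>"
    and ab: "(a, b) \<in> index_pairs N"
  shows "weight \<gamma> (a, b) = \<mu>" and "weight \<gamma> (c, d) = \<mu>"
proof -
  have "weight \<gamma> (a, b) \<le> \<mu>"
    using newton_edge_supports[OF edge, of r] attained newton_points_subset_polygon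
    by (auto simp: \<gamma>[symmetric] tilt_pair_point)
  thus ab': "weight \<gamma> (a, b) = \<mu>" using bspec[OF min(2) ab] by simp
  show "weight \<gamma> (c, d) = \<mu>"
    using tilt_slope[of "pair_point x \<beta> a b" "pair_point x \<beta> c d"] edge ab'
    by (simp add: newton_edge_def \<gamma>[symmetric] tilt_pair_point)
qed

text \<open>
  An edge between the points of two pairs cannot have this slope: with the origin there would be
  three minimizers.
\<close>
lemma associated_pair_of_dominant_edge:
  assumes uniq: "slopes_unique N x \<beta>" and \<gamma>: "\<gamma> > 0"
    and min: "\<forall>p\<in>index_pairs N. 0 \<le> weight \<gamma> p"
    and cd: "(c, d) \<in> index_pairs N" "weight \<gamma> (c, d) = 0"
  shows "associated_pair N x \<beta> \<gamma> j k \<longleftrightarrow> (j, k) = (c, d)"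
proof
  have \<gamma>cd: "\<gamma> = gamma_sum x \<beta> c d" using weight_gamma_sum(2)[OF cd(1)] cd(2) by simp
  note unique = minimizing_pair_unique[OF uniq \<gamma> min]
  show "associated_pair N x \<beta> \<gamma> j k" if "(j, k) = (c, d)"
    using that cd(1) min dominant_pair_iff[OF cd(1)] \<gamma>cd
    by (auto simp: associated_pair_def index_pairs_def)
  assume "associated_pair N x \<beta> \<gamma> j k"
  then consider "dominant_pair N x \<beta> j k" "\<gamma> = gamma_sum x \<beta> j k"
    | a b e f where "(a, b) \<in> index_pairs N" "(e, f) \<in> index_pairs N"
        "newton_edge N x \<beta> (pair_point x \<beta> a b) (pair_point x \<beta> e f)"
        "\<gamma> = slope (pair_point x \<beta> a b) (pair_point x \<beta> e f)"
    unfolding associated_pair_def index_pairs_def by auto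
  thus "(j, k) = (c, d)"
  proof cases
    case 1
    hence jk: "(j, k) \<in> index_pairs N" by (simp add: dominant_pair_def index_pairs_def)
    show ?thesis using unique[OF jk _ cd] weight_gamma_sum(2)[OF jk] 1 by blast
  next
    case 2
    have "weight \<gamma> (a, b) = 0" "weight \<gamma> (e, f) = 0"
      using pair_edge_weights[OF 2(3,4) order_refl min, of "(0, 0)"] 2(1)
      by (auto simp: newton_points_eq tilt_def)
    hence "(a, b) = (e, f)" using unique 2(1,2) by blast
    thus ?thesis using 2(3) by (simp add: newton_edge_def)
  qed
qed

text \<open>
  The two minimizing pairs share their left or their right index. Which of the unshared indices
  belongs to which pair is determined by the order of the abscissae: the right endpoint of the edge
  is the longer interval.
\<close>
lemma associated_pair_of_secondary_edge:
  assumes uniq: "slopes_unique N x \<beta>" and \<gamma>: "\<gamma> > 0" and \<mu>: "\<mu> < 0"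
    and min: "\<forall>p\<in>index_pairs N. \<mu> \<le> weight \<gamma> p"
    and edge: "newton_edge N x \<beta> (pair_point x \<beta> a b) (pair_point x \<beta> c d)"
    and slope: "\<gamma> = slope (pair_point x \<beta> a b) (pair_point x \<beta> c d)"
    and ab: "(a, b) \<in> index_pairs N" "weight \<gamma> (a, b) = \<mu>"
    and cd: "(c, d) \<in> index_pairs N" "weight \<gamma> (c, d) = \<mu>"
  obtains s j k where "(j, k) \<in> index_pairs N"
    "(a, b) = (s, j) \<and> (c, d) = (s, k) \<or> (a, b) = (k, s) \<and> (c, d) = (j, s)"
    "\<And>j' k'. associated_pair N x \<beta> \<gamma> j' k' \<longleftrightarrow> (j', k') = (j, k)"
proof -
  have lt: "x b - x a < x d - x c" using edge by (simp add: newton_edge_def pair_point_def)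
  have less: "i < i'" if "x i < x i'" "i \<in> {1..N}" "i' \<in> {1..N}" for i i'
    using strict_mono_on_less[OF x_mono] that by blast
  have range: "a \<in> {1..N}" "b \<in> {1..N}" "c \<in> {1..N}" "d \<in> {1..N}" "a < b" "c < d"
    using ab(1) cd(1) by (auto simp: index_pairs_def)
  obtain s j k where jk: "(j, k) \<in> index_pairs N"
    and orient: "(a, b) = (s, j) \<and> (c, d) = (s, k) \<or> (a, b) = (k, s) \<and> (c, d) = (j, s)"
  proof -
    from minimizing_pairs_share_index[OF uniq \<gamma> less_imp_le[OF \<mu>] min ab cd]
    show ?thesis
    proof
      assume "a = c"
      hence "b < d" using lt range by (intro less) auto
      thus ?thesis using that[of b d a] range \<open>a = c\<close> by (auto simp: index_pairs_def)
    next
      assume "b = d"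
      hence "c < a" using lt range by (intro less) auto
      thus ?thesis using that[of c a b] range \<open>b = d\<close> by (auto simp: index_pairs_def)
    qed
  qed
  have sd: "sym_diff {a, b} {c, d} = {j, k}"
    using orient jk range by (auto simp: index_pairs_def)
  have neq: "(a, b) \<noteq> (c, d)" using lt by auto
  have "associated_pair N x \<beta> \<gamma> j' k' \<longleftrightarrow> (j', k') = (j, k)" for j' k'
  proof
    assume "(j', k') = (j, k)"
    thus "associated_pair N x \<beta> \<gamma> j' k'"
      unfolding associated_pair_def using jk ab(1) cd(1) edge slope sd
      by (auto simp: index_pairs_def)
  next
    assume "associated_pair N x \<beta> \<gamma> j' k'"
    then consider "dominant_pair N x \<beta> j' k'" "\<gamma> = gamma_sum x \<beta> j' k'"
      | a' b' c' d' where "(a', b') \<in> index_pairs N" "(c', d') \<in> index_pairs N"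
          "newton_edge N x \<beta> (pair_point x \<beta> a' b') (pair_point x \<beta> c' d')"
          "\<gamma> = slope (pair_point x \<beta> a' b') (pair_point x \<beta> c' d')"
          "sym_diff {a', b'} {c', d'} = {j', k'}" "j' < k'"
      unfolding associated_pair_def index_pairs_def by auto
    thus "(j', k') = (j, k)"
    proof cases
      case 1
      hence jk': "(j', k') \<in> index_pairs N" by (simp add: dominant_pair_def index_pairs_def)
      have "0 \<le> weight \<gamma> (a, b)" using dominant_pair_iff[OF jk'] 1 ab(1) by blast
      thus ?thesis using ab(2) \<mu> by simp
    next
      case 2
      have "pair_point x \<beta> a b \<in> newton_points N x \<beta>" using ab(1) by (force simp: newton_points_eq)
      moreover have "tilt \<gamma> (pair_point x \<beta> a b) = \<mu>" using ab(2) by (simp add: tilt_pair_point)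
      ultimately have w: "weight \<gamma> (a', b') = \<mu>" "weight \<gamma> (c', d') = \<mu>"
        using pair_edge_weights[OF 2(3,4) less_imp_le[OF \<mu>] min _ _ 2(1)] by blast+
      have two: "p = (a, b) \<or> p = (c, d)" if "p \<in> index_pairs N" "weight \<gamma> p = \<mu>" for p
        using at_most_two_minimizing_pairs[OF uniq \<gamma> less_imp_le[OF \<mu>] min ab cd that neq] .
      have lt': "x b' - x a' < x d' - x c'" using 2(3) by (simp add: newton_edge_def pair_point_def)
      have "a' = a \<and> b' = b \<and> c' = c \<and> d' = d"
        using two[OF 2(1) w(1)] two[OF 2(2) w(2)] lt lt' by auto
      hence "{j', k'} = {j, k}" using 2(5) sd by simp
      thus ?thesis using 2(6) jk by (auto simp: index_pairs_def doubleton_eq_iff)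
    qed
  qed
  thus ?thesis using that jk orient by blast
qed

text \<open>
  The string comes from the case \<open>M = 2\<close>, in which the only admissible centre is 1.
\<close>
lemma string_and_resonances:
  assumes jk: "(j, k) \<in> index_pairs N"
    and assoc: "\<And>j' k'. associated_pair N x \<beta> \<gamma> j' k' \<longleftrightarrow> (j', k') = (j, k)"
    and res: "\<And>M. M > 0 \<Longrightarrow> \<exists>h0>0. \<exists>r\<in>o[at_right 0](\<lambda>h. h). \<forall>h\<in>{0<..<h0}. \<forall>m::int.
      pi * h * of_int m / (x k - x j) \<in> {2 / M..M / 2} \<longrightarrow>
        (\<exists>z. is_resonance N x C \<beta> h z \<and> cmod (z - Z j k h m) \<le> r h)"
    and Z: "\<And>h m. pi * h * of_int m / (x k - x j) = 1 \<Longrightarrow> Z j k h m = ansatz \<gamma> h 1 w"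
  shows "(\<exists>hs zs. resonance_string N x C \<beta> \<gamma> hs zs) \<and>
    (\<exists>j k. associated_pair N x \<beta> \<gamma> j k) \<and>
    (\<forall>j k. associated_pair N x \<beta> \<gamma> j k \<longrightarrow>
      (\<forall>\<^sub>F M in at_top. \<exists>h0>0. \<exists>r\<in>o[at_right 0](\<lambda>h. h). \<forall>h\<in>{0<..<h0}. \<forall>m::int.
        pi * h * of_int m / (x k - x j) \<in> {2 / M..M / 2} \<longrightarrow>
          (\<exists>z. is_resonance N x C \<beta> h z \<and> cmod (z - Z j k h m) \<le> r h)))"
proof (intro conjI allI impI)
  obtain h0 r where "h0 > 0" and r: "r \<in> o[at_right 0](\<lambda>h. h)"
    and "\<forall>h\<in>{0<..<h0}. \<forall>m::int. pi * h * of_int m / (x k - x j) \<in> {2 / 2..2 / 2} \<longrightarrow>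
        (\<exists>z. is_resonance N x C \<beta> h z \<and> cmod (z - Z j k h m) \<le> r h)"
    using res[of 2] by auto
  thus "\<exists>hs zs. resonance_string N x C \<beta> \<gamma> hs zs"
    using x_less[OF jk] Z by (intro resonance_string_if_resonances[of "x k - x j" h0 r]) fastforce+
  show "\<exists>j k. associated_pair N x \<beta> \<gamma> j k" using assoc by blast
  fix j' k' assume "associated_pair N x \<beta> \<gamma> j' k'"
  hence "j' = j" "k' = k" using assoc by auto
  thus "\<forall>\<^sub>F M in at_top. \<exists>h0>0. \<exists>r\<in>o[at_right 0](\<lambda>h. h). \<forall>h\<in>{0<..<h0}. \<forall>m::int.
      pi * h * of_int m / (x k' - x j') \<in> {2 / M..M / 2} \<longrightarrow>
        (\<exists>z. is_resonance N x C \<beta> h z \<and> cmod (z - Z j' k' h m) \<le> r h)"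
    using eventually_mono[OF eventually_gt_at_top[of 0] res] by simp
qed

text \<open>
  The supporting line of slope \<open>\<gamma>\<close> passes through the origin or below it, that is \<open>\<mu> = 0\<close> or
  \<open>\<mu> < 0\<close>; the edge is the dominant one or a secondary one accordingly.
\<close>
lemma newton_slope_string:
  assumes uniq: "slopes_unique N x \<beta>" and dom: "dominant_pair N x \<beta> J K"
    and \<gamma>: "\<gamma> \<in> newton_slopes N x \<beta>"
  shows "(\<exists>hs zs. resonance_string N x C \<beta> \<gamma> hs zs) \<and>
    (\<exists>j k. associated_pair N x \<beta> \<gamma> j k) \<and>
    (\<forall>j k. associated_pair N x \<beta> \<gamma> j k \<longrightarrow>
      (\<forall>\<^sub>F M in at_top. \<exists>h0>0. \<exists>r\<in>o[at_right 0](\<lambda>h. h). \<forall>h\<in>{0<..<h0}. \<forall>m::int.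
        pi * h * of_int m / (x k - x j) \<in> {2 / M..M / 2} \<longrightarrow>
          (\<exists>z. is_resonance N x C \<beta> h z \<and>
            cmod (z - (if \<gamma> = gamma_sum x \<beta> J K
                       then z_dominant x C \<beta> j k h m
                       else z_secondary x C \<beta> j k h m)) \<le> r h)))"
proof -
  have JK: "(J, K) \<in> index_pairs N" using dom by (simp add: dominant_pair_def index_pairs_def)
  obtain p q where edge: "newton_edge N x \<beta> p q" and slope: "\<gamma> = slope p q"
    using \<gamma> by (auto simp: newton_slopes_def)
  obtain \<mu> where \<gamma>0: "\<gamma> > 0" and \<mu>: "\<mu> \<le> 0" and min: "\<forall>r\<in>index_pairs N. \<mu> \<le> weight \<gamma> r"
    and tilts: "tilt \<gamma> p = \<mu>" "tilt \<gamma> q = \<mu>"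
    and p: "p = (0, 0) \<or> (\<exists>a b. (a, b) \<in> index_pairs N \<and> p = pair_point x \<beta> a b)"
    and q: "\<exists>c d. (c, d) \<in> index_pairs N \<and> q = pair_point x \<beta> c d"
    using newton_edge_minimizers[OF edge slope] by blast
  obtain c d where cd: "(c, d) \<in> index_pairs N" "q = pair_point x \<beta> c d" using q by blast
  have wcd: "weight \<gamma> (c, d) = \<mu>" using tilts cd by (simp add: tilt_pair_point)
  show ?thesis
  proof (cases "\<mu> = 0")
    case True
    have min0: "\<forall>p\<in>index_pairs N. 0 \<le> weight \<gamma> p" and w0: "weight \<gamma> (c, d) = 0"
      using min wcd True by auto
    have \<gamma>cd: "\<gamma> = gamma_sum x \<beta> c d" using weight_gamma_sum(2)[OF cd(1)] w0 by simp
    have "\<gamma> \<le> gamma_sum x \<beta> J K" using weight_gamma_sum(1)[OF JK] bspec[OF min0 JK] by simp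
    moreover have "gamma_sum x \<beta> J K \<le> \<gamma>"
      using dom cd(1) by (simp add: \<gamma>cd dominant_pair_def index_pairs_def)
    ultimately have \<gamma>JK: "\<gamma> = gamma_sum x \<beta> J K" by simp
    have only: "{p \<in> index_pairs N. weight \<gamma> p = 0} = {(c, d)}"
      using minimizing_pair_unique[OF uniq \<gamma>0 min0 _ _ cd(1) w0] cd(1) w0 by blast
    have "z_dominant x C \<beta> c d h m = ansatz \<gamma> h 1
        (\<i> * Ln (of_real (- C c * C d / (4 * 1\<^sup>2))) / of_real (2 * (x d - x c)))"
      if "pi * h * of_int m / (x d - x c) = 1" for h m
      unfolding z_dominant_eq_ansatz[OF x_less[OF cd(1)]] Let_def that \<gamma>cd ..
    from string_and_resonances[where Z = "z_dominant x C \<beta>", OF cd(1) associated_pair_of_dominant_edge[OF uniq \<gamma>0 min0 cd(1) w0]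
        dominant_resonances[OF cd(1) \<gamma>0 \<gamma>cd _ min0 only] this]
    show ?thesis unfolding if_P[OF \<gamma>JK] .
  next
    case False
    hence \<mu>0: "\<mu> < 0" using \<mu> by simp
    have "p \<noteq> (0, 0)" using tilts(1) False by (auto simp: tilt_def)
    then obtain a b where ab: "(a, b) \<in> index_pairs N" "p = pair_point x \<beta> a b" using p by blast
    have wab: "weight \<gamma> (a, b) = \<mu>" using tilts ab by (simp add: tilt_pair_point)
    have neq: "(a, b) \<noteq> (c, d)" using edge ab(2) cd(2) by (auto simp: newton_edge_def)
    have "\<gamma> \<noteq> gamma_sum x \<beta> J K"
    proof
      assume "\<gamma> = gamma_sum x \<beta> J K"
      hence "0 \<le> weight \<gamma> (a, b)" using dominant_pair_iff[OF JK] dom ab(1) by blast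
      thus False using wab \<mu>0 by simp
    qed
    note not_dominant = if_not_P[OF this]
    obtain s j k where jk: "(j, k) \<in> index_pairs N"
      and orient: "(a, b) = (s, j) \<and> (c, d) = (s, k) \<or> (a, b) = (k, s) \<and> (c, d) = (j, s)"
      and assoc: "\<And>j' k'. associated_pair N x \<beta> \<gamma> j' k' \<longleftrightarrow> (j', k') = (j, k)"
      using associated_pair_of_secondary_edge[OF uniq \<gamma>0 \<mu>0 min edge[unfolded ab(2) cd(2)]
          slope[unfolded ab(2) cd(2)] ab(1) wab cd(1) wcd] by blast
    have only: "{p \<in> index_pairs N. weight \<gamma> p = \<mu>} = {(a, b), (c, d)}"
      using at_most_two_minimizing_pairs[OF uniq \<gamma>0 \<mu> min ab(1) wab cd(1) wcd _ _ neq]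
        ab(1) wab cd(1) wcd by blast
    note res = secondary_resonances[OF ab(1) cd(1) jk orient \<gamma>0 _ \<mu>0 min only]
    have "z_secondary x C \<beta> j k h m = ansatz \<gamma> h 1
        (\<i> * Ln (of_real (if \<beta> k < \<beta> j then - C j / C k else - C k / C j)) / of_real (2 * (x k - x j)))"
      if "pi * h * of_int m / (x k - x j) = 1" for h m
      unfolding z_secondary_eq_ansatz that res(1)[OF zero_less_one] ..
    from string_and_resonances[where Z = "z_secondary x C \<beta>", OF jk assoc res(2) this]
    show ?thesis unfolding not_dominant .
  qed
qed

end

theorem theorem4:
  fixes N :: nat and x C \<beta> :: "nat \<Rightarrow> real" and J K :: nat
  assumes "N \<ge> 2"
    and "strict_mono_on {1..N} x"
    and "\<And>j. j \<in> {1..N} \<Longrightarrow> C j \<noteq> 0"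
    and "\<And>j. j \<in> {1..N} \<Longrightarrow> \<beta> j > 0"
    and "slopes_unique N x \<beta>"
    and "dominant_pair N x \<beta> J K"
  shows "gamma_sum x \<beta> J K \<in> newton_slopes N x \<beta> \<and>
    (\<forall>\<gamma>\<in>newton_slopes N x \<beta>.
      (\<exists>hs zs. resonance_string N x C \<beta> \<gamma> hs zs) \<and>
      (\<exists>j k. associated_pair N x \<beta> \<gamma> j k) \<and>
      (\<forall>j k. associated_pair N x \<beta> \<gamma> j k \<longrightarrow>
        (\<forall>\<^sub>F M in at_top. \<exists>h0>0. \<exists>r\<in>o[at_right 0](\<lambda>h. h).
          \<forall>h\<in>{0<..<h0}. \<forall>m::int.
            pi * h * of_int m / (x k - x j) \<in> {2 / M..M / 2} \<longrightarrow>
            (\<exists>z. is_resonance N x C \<beta> h z \<and>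
              cmod (z - (if \<gamma> = gamma_sum x \<beta> J K
                         then z_dominant x C \<beta> j k h m
                         else z_secondary x C \<beta> j k h m)) \<le> r h))))"
proof -
  interpret point_interactions N x C \<beta>
    using assms(2-4) by unfold_locales
  show ?thesis
    using dominant_slope_in_newton_slopes[OF assms(5,6)] newton_slope_string[OF assms(5,6)] by blast
qed

end
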